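(* Let $G$ be any group in which all rank one abelian subgroups are isomorphic to $\mathbb{Z}$. If $P\in LO(G)$ corresponds to a dense left ordering $<$ of $G$, then $P$ is an accumulation point, in $LO(G)$, of positive cones whose associated left orderings are dense orderings; that is, every open neighbourhood of $P$ in $LO(G)$ contains a positive cone $P'\neq P$ whose associated left ordering is dense.
   Context: A left ordering of a group $G$ is a strict total ordering $<$ of $G$ such that $g<h$ implies $fg<fh$ for all $f,g,h\in G$. Its positive cone is $P=\{g\in G: g>1\}$. Positive cones are exactly the subsets $P\subset G$ with $PP\subset P$ such that for every $g\in G$ exactly one of $g\in P$, $g^{-1}\in P$, $g=1$ holds; the associated ordering is $g<h$ iff $g^{-1}h\in P$. $LO(G)\subset 2^G$ is the set of all positive cones of $G$, with the subspace topology from the product topology on $2^G$; a subbasis is given by the sets $U_g=\{P\in LO(G): g\in P\}$, $g\in G$. A left ordering is dense if whenever $g<h$ there exists $f\in G$ with $g<f<h$. The rank of a torsion-free abelian group $A$ is $\dim_{\mathbb{Q}}(A\otimes\mathbb{Q})$.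
   Formalization: The group G is assumed nontrivial; for the trivial group LO(G) is a single point whose empty ordering is vacuously dense, so it is not an accumulation point and the claim fails. *)

theory Defs
  imports
    "HOL-Analysis.Analysis"
    "HOL-Algebra.Free_Abelian_Groups"
    "HOL-Algebra.Elementary_Groups"
    "Jordan_Normal_Form.VS_Connect"
begin

section \<open>Left orderings and positive cones\<close>

definition left_ordering :: "('a, 'm) monoid_scheme \<Rightarrow> ('a \<times> 'a) set \<Rightarrow> bool" where
  "left_ordering G r \<longleftrightarrow>
     r \<subseteq> carrier G \<times> carrier G \<and> strict_linear_order_on (carrier G) r \<and>
     (\<forall>f\<in>carrier G. \<forall>g h. (g, h) \<in> r \<longrightarrow> (f \<otimes>\<^bsub>G\<^esub> g, f \<otimes>\<^bsub>G\<^esub> h) \<in> r)"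

definition dense_ordering :: "('a \<times> 'a) set \<Rightarrow> bool" where
  "dense_ordering r \<longleftrightarrow> (\<forall>g h. (g, h) \<in> r \<longrightarrow> (\<exists>f. (g, f) \<in> r \<and> (f, h) \<in> r))"

definition positive_cone :: "('a, 'm) monoid_scheme \<Rightarrow> ('a \<times> 'a) set \<Rightarrow> 'a set" where
  "positive_cone G r = {g \<in> carrier G. (\<one>\<^bsub>G\<^esub>, g) \<in> r}"

definition LO :: "('a, 'm) monoid_scheme \<Rightarrow> 'a set set" where
  "LO G = positive_cone G ` {r. left_ordering G r}"

definition cone_ordering :: "('a, 'm) monoid_scheme \<Rightarrow> 'a set \<Rightarrow> ('a \<times> 'a) set" where
  "cone_ordering G P =
     {(g, h). g \<in> carrier G \<and> h \<in> carrier G \<and> inv\<^bsub>G\<^esub> g \<otimes>\<^bsub>G\<^esub> h \<in> P}"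

lemma (in group) cone_ordering_positive_cone:
  assumes "left_ordering G r"
  shows "cone_ordering G (positive_cone G r) = r"
proof -
  have r: "r \<subseteq> carrier G \<times> carrier G"
    and li: "\<And>f g h. f \<in> carrier G \<Longrightarrow> (g, h) \<in> r \<Longrightarrow> (f \<otimes> g, f \<otimes> h) \<in> r"
    using assms by (auto simp: left_ordering_def)
  have "(\<one>, inv g \<otimes> h) \<in> r \<longleftrightarrow> (g, h) \<in> r" if "g \<in> carrier G" "h \<in> carrier G" for g h
    using li[of g \<one> "inv g \<otimes> h"] li[of "inv g" g h] that
    by (auto simp: m_assoc[symmetric])
  then show ?thesis
    using r by (auto simp: cone_ordering_def positive_cone_def)
qed

lemma (in group) LO_iff:
  "P \<in> LO G \<longleftrightarrow> P \<subseteq> carrier G \<and> (\<forall>g\<in>P. \<forall>h\<in>P. g \<otimes> h \<in> P) \<and>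
     \<one> \<notin> P \<and> (\<forall>g\<in>carrier G. g \<noteq> \<one> \<longrightarrow> (g \<in> P) \<noteq> (inv g \<in> P))"
  (is "_ \<longleftrightarrow> ?R")
proof
  assume "P \<in> LO G"
  then obtain r where lo: "left_ordering G r" and P: "P = positive_cone G r"
    by (auto simp: LO_def)
  have "trans r" and ir: "\<And>x. (x, x) \<notin> r" and tot: "total_on (carrier G) r"
    and li: "\<And>f g h. f \<in> carrier G \<Longrightarrow> (g, h) \<in> r \<Longrightarrow> (f \<otimes> g, f \<otimes> h) \<in> r"
    using lo unfolding left_ordering_def strict_linear_order_on_def irrefl_def by blast+
  then have tr: "\<And>x y z. (x, y) \<in> r \<Longrightarrow> (y, z) \<in> r \<Longrightarrow> (x, z) \<in> r"
    by (meson transD)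
  have "g \<otimes> h \<in> P" if "g \<in> P" "h \<in> P" for g h
    using that li[of g \<one> h] tr[of \<one> g "g \<otimes> h"] by (simp add: P positive_cone_def)
  moreover have "(g \<in> P) \<noteq> (inv g \<in> P)" if g: "g \<in> carrier G" "g \<noteq> \<one>" for g
  proof -
    have "(\<one>, g) \<in> r \<or> (g, \<one>) \<in> r"
      using tot g by (auto simp: total_on_def)
    moreover have "(g, \<one>) \<in> r \<longleftrightarrow> (\<one>, inv g) \<in> r"
      using li[of "inv g" g \<one>] li[of g \<one> "inv g"] g by auto
    ultimately show ?thesis
      using tr[of \<one> g \<one>] ir[of \<one>] g(1) by (auto simp: P positive_cone_def)
  qed
  moreover have "P \<subseteq> carrier G" "\<one> \<notin> P"
    using ir[of \<one>] by (auto simp: P positive_cone_def)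
  ultimately show ?R
    by blast
next
  assume R: ?R
  let ?r = "cone_ordering G P"
  have sub: "P \<subseteq> carrier G" and one: "\<one> \<notin> P"
    and mul: "\<And>g h. g \<in> P \<Longrightarrow> h \<in> P \<Longrightarrow> g \<otimes> h \<in> P"
    and tri: "\<And>g. g \<in> carrier G \<Longrightarrow> g \<noteq> \<one> \<Longrightarrow> (g \<in> P) \<noteq> (inv g \<in> P)"
    using R by blast+
  have "trans ?r"
  proof (rule transI)
    fix x y z assume xy: "(x, y) \<in> ?r" and yz: "(y, z) \<in> ?r"
    have c: "x \<in> carrier G" "y \<in> carrier G" "z \<in> carrier G"
      using xy yz by (auto simp: cone_ordering_def)
    have "y \<otimes> (inv y \<otimes> z) = z"
      using c by (simp add: m_assoc[symmetric])
    then have "inv x \<otimes> z = (inv x \<otimes> y) \<otimes> (inv y \<otimes> z)"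
      using c by (simp add: m_assoc)
    then show "(x, z) \<in> ?r"
      using mul xy yz c by (simp add: cone_ordering_def)
  qed
  moreover have "irrefl ?r"
    using one by (auto simp: irrefl_def cone_ordering_def)
  moreover have "total_on (carrier G) ?r"
  proof (rule total_onI)
    fix x y assume c: "x \<in> carrier G" "y \<in> carrier G" "x \<noteq> y"
    have "inv x \<otimes> y \<noteq> \<one>"
      using c by (metis inv_equality inv_inv inv_closed)
    moreover have "inv (inv x \<otimes> y) = inv y \<otimes> x"
      using c by (simp add: inv_mult_group)
    ultimately show "(x, y) \<in> ?r \<or> (y, x) \<in> ?r"
      using tri[of "inv x \<otimes> y"] c by (auto simp: cone_ordering_def)
  qed
  moreover have "(f \<otimes> g, f \<otimes> h) \<in> ?r" if "f \<in> carrier G" "(g, h) \<in> ?r" for f g h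
  proof -
    have c: "g \<in> carrier G" "h \<in> carrier G" "f \<in> carrier G"
      using that by (auto simp: cone_ordering_def)
    have "inv (f \<otimes> g) \<otimes> (f \<otimes> h) = inv g \<otimes> (inv f \<otimes> (f \<otimes> h))"
      using c by (simp add: inv_mult_group m_assoc)
    also have "inv f \<otimes> (f \<otimes> h) = h"
      using c by (simp add: m_assoc[symmetric])
    finally show ?thesis
      using that by (auto simp: cone_ordering_def)
  qed
  ultimately have "left_ordering G ?r"
    by (auto simp: left_ordering_def strict_linear_order_on_def cone_ordering_def)
  moreover have "P = positive_cone G ?r"
    using sub by (auto simp: positive_cone_def cone_ordering_def)
  ultimately show "P \<in> LO G"
    by (auto simp: LO_def)
qed

text \<open>The subspace topology that \<open>LO G\<close> inherits from the product topology on \<open>2\<^sup>G\<close>, where a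
  subset of the carrier is identified with its characteristic function, and the factor \<open>2\<close> is
  the type \<^typ>\<open>bool\<close> with the discrete topology.\<close>

definition LO_topology :: "('a, 'm) monoid_scheme \<Rightarrow> 'a set topology" where
  "LO_topology G = pullback_topology (LO G) (\<lambda>P. \<lambda>g\<in>carrier G. g \<in> P)
     (product_topology (\<lambda>_. discrete_topology (UNIV :: bool set)) (carrier G))"

lemma topspace_LO_topology [simp]: "topspace (LO_topology G) = LO G"
  by (auto simp: LO_topology_def topspace_pullback_topology)

lemma openin_LO_topology_subbasic:
  assumes "g \<in> carrier G"
  shows "openin (LO_topology G) {P \<in> LO G. g \<in> P}"
proof -
  let ?X = "product_topology (\<lambda>_. discrete_topology (UNIV :: bool set)) (carrier G)"
  have "openin ?X {f \<in> topspace ?X. f g \<in> {True}}"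
    by (rule openin_continuous_map_preimage[OF continuous_map_product_projection[OF assms]]) auto
  moreover have "{P \<in> LO G. g \<in> P} =
      (\<lambda>P. \<lambda>g\<in>carrier G. g \<in> P) -` {f \<in> topspace ?X. f g \<in> {True}} \<inter> LO G"
    using assms by auto
  ultimately show ?thesis
    unfolding LO_topology_def openin_pullback_topology by blast
qed

section \<open>Rank of an abelian group\<close>

text \<open>The group \<open>A\<close> is written multiplicatively, so \<open>(a \<otimes> b, q)\<close> below is the pair
  \<open>(a + b, q)\<close>.\<close>

definition tensor_rat_relators :: "('a, 'm) monoid_scheme \<Rightarrow> ('a \<times> rat \<Rightarrow>\<^sub>0 int) set" where
  "tensor_rat_relators A =
     {frag_of (a \<otimes>\<^bsub>A\<^esub> b, q) - frag_of (a, q) - frag_of (b, q) | a b q.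
        a \<in> carrier A \<and> b \<in> carrier A} \<union>
     {frag_of (a, p + q) - frag_of (a, p) - frag_of (a, q) | a p q. a \<in> carrier A}"

abbreviation tensor_rat_free :: "('a, 'm) monoid_scheme \<Rightarrow> ('a \<times> rat \<Rightarrow>\<^sub>0 int) monoid" where
  "tensor_rat_free A \<equiv> free_Abelian_group (carrier A \<times> (UNIV :: rat set))"

abbreviation tensor_rat_kernel :: "('a, 'm) monoid_scheme \<Rightarrow> ('a \<times> rat \<Rightarrow>\<^sub>0 int) set" where
  "tensor_rat_kernel A \<equiv> generate (tensor_rat_free A) (tensor_rat_relators A)"

definition tensor_rat_scale :: "rat \<Rightarrow> ('a \<times> rat \<Rightarrow>\<^sub>0 int) \<Rightarrow> ('a \<times> rat \<Rightarrow>\<^sub>0 int)" where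
  "tensor_rat_scale q = frag_extend (\<lambda>(a, r). frag_of (a, q * r))"

text \<open>The tensor product \<open>A \<otimes> \<rat>\<close> over \<open>\<int>\<close> as a vector space over \<open>\<rat>\<close>; its elements are cosets
  of the subgroup \<open>N\<close> generated by the bilinearity relators. The scalar multiplication is the map
  \<open>N + x \<mapsto> N + q x\<close>; multiplying the image by \<open>N\<close> is only needed for \<open>q = 0\<close>, where the image of
  a coset is not a full coset. The multiplicative fields of a module record are irrelevant.\<close>

definition tensor_rat ::
  "('a, 'm) monoid_scheme \<Rightarrow> (rat, ('a \<times> rat \<Rightarrow>\<^sub>0 int) set) module" where
  "tensor_rat A =
     \<lparr>carrier = carrier (tensor_rat_free A Mod tensor_rat_kernel A),
      mult = (\<lambda>_ _. undefined), one = undefined,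
      zero = \<one>\<^bsub>tensor_rat_free A Mod tensor_rat_kernel A\<^esub>,
      add = mult (tensor_rat_free A Mod tensor_rat_kernel A),
      smult = (\<lambda>q C. tensor_rat_kernel A <#>\<^bsub>tensor_rat_free A\<^esub> (tensor_rat_scale q ` C))\<rparr>"

lemma vectorspace_tensor_rat:
  fixes A :: "('a, 'm) monoid_scheme"
  assumes "comm_group A"
  shows "vectorspace class_ring (tensor_rat A)"
proof -
  define F where "F = tensor_rat_free A"
  define N where "N = tensor_rat_kernel A"
  define cs where "cs x = N #>\<^bsub>F\<^esub> x" for x
  interpret A: comm_group A by fact
  interpret F: comm_group F unfolding F_def by (rule abelian_free_Abelian_group)
  have F_simps: "\<And>x. x \<in> carrier F \<longleftrightarrow> Poly_Mapping.keys x \<subseteq> carrier A \<times> UNIV"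
      "\<And>x y. x \<otimes>\<^bsub>F\<^esub> y = x + y" "\<one>\<^bsub>F\<^esub> = 0"
    by (auto simp: F_def)
  have diff_F: "x - y \<in> carrier F" if "x \<in> carrier F" "y \<in> carrier F" for x y
    using that keys_diff[of x y] unfolding F_simps by blast
  have frag_F: "frag_of (a, q) \<in> carrier F" if "a \<in> carrier A" for a q
    using that by (simp add: F_simps)
  have rel: "tensor_rat_relators A \<subseteq> carrier F"
    unfolding tensor_rat_relators_def by (auto intro!: diff_F frag_F)
  have N_eq: "N = generate F (tensor_rat_relators A)"
    by (simp add: N_def F_def)
  have subN: "subgroup N F"
    unfolding N_eq using rel by (rule F.generate_is_subgroup)
  have normN: "N \<lhd> F"
    using subN by (simp add: F.normal_iff_subgroup)
  have N_F: "N \<subseteq> carrier F"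
    using subN by (rule subgroup.subset)
  have N0: "0 \<in> N" and N_add: "\<And>x y. x \<in> N \<Longrightarrow> y \<in> N \<Longrightarrow> x + y \<in> N"
    using subgroup.one_closed[OF subN] subgroup.m_closed[OF subN] by (simp_all add: F_simps)
  have N_minus: "- x \<in> N" if "x \<in> N" for x
    using subgroup.m_inv_closed[OF subN that] N_F that
    by (metis F_def F_simps(1) inv_free_Abelian_group subsetD)
  have N_diff: "x - y \<in> N" if "x \<in> N" "y \<in> N" for x y
    using N_add[OF that(1) N_minus[OF that(2)]] by simp
  have cs: "cs x = (\<lambda>n. n + x) ` N" for x
    by (auto simp: cs_def r_coset_def F_simps)
  have cs_eq: "cs x = cs y" if "x - y \<in> N" for x y
  proof -
    have "n + x = (n + (x - y)) + y" "n + y = (n - (x - y)) + x" for n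
      by simp_all
    then show ?thesis
      unfolding cs using N_add N_diff that by (metis (no_types, lifting) image_subset_iff image_eqI subset_antisym)
  qed
  have scale_diff: "tensor_rat_scale q (x - y) = tensor_rat_scale q x - tensor_rat_scale q y" for q x y
    by (simp add: tensor_rat_scale_def frag_extend_diff)
  have scale_add: "tensor_rat_scale q (x + y) = tensor_rat_scale q x + tensor_rat_scale q y" for q x y
    by (simp add: tensor_rat_scale_def frag_extend_add)
  have scale_0: "tensor_rat_scale q 0 = 0" for q
    by (simp add: tensor_rat_scale_def)
  have scale_of: "tensor_rat_scale q (frag_of (a, r)) = frag_of (a, q * r)" for q a r
    by (simp add: tensor_rat_scale_def)
  have scale_F: "tensor_rat_scale q x \<in> carrier F" if "x \<in> carrier F" for q x
    using that unfolding F_simps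
    by (induction rule: frag_induction)
      (use diff_F frag_F in \<open>auto simp: scale_0 scale_of scale_diff F_simps\<close>)
  have scale_rel: "tensor_rat_scale q x \<in> tensor_rat_relators A" if "x \<in> tensor_rat_relators A" for q x
    using that unfolding tensor_rat_relators_def
    by (elim UnE CollectE exE conjE) (simp add: scale_diff scale_of distrib_left, blast)+
  have scale_N: "tensor_rat_scale q x \<in> N" if "x \<in> N" for q x
    using that unfolding N_eq
  proof (induction rule: generate.induct)
    case one
    then show ?case using N0 by (simp add: F_simps scale_0 N_eq)
  next
    case (incl h)
    then show ?case by (intro generate.incl scale_rel)
  next
    case (inv h)
    have "h \<in> carrier F" using inv rel by blast
    then have "inv\<^bsub>F\<^esub> h = 0 - h" by (simp add: F_simps F_def)
    moreover have "tensor_rat_scale q h \<in> N"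
      unfolding N_eq using inv by (intro generate.incl scale_rel)
    ultimately show ?case
      using N_minus by (simp add: scale_diff scale_0 N_eq[symmetric] del: diff_0) simp
  next
    case (eng h1 h2)
    then show ?case
      using N_add by (simp add: F_simps scale_add N_eq[symmetric])
  qed
  have smult: "q \<odot>\<^bsub>tensor_rat A\<^esub> cs x = cs (tensor_rat_scale q x)" for q x
  proof -
    have "q \<odot>\<^bsub>tensor_rat A\<^esub> cs x = N <#>\<^bsub>F\<^esub> (tensor_rat_scale q ` cs x)"
      by (simp add: tensor_rat_def N_def F_def)
    also have "\<dots> = {m + (tensor_rat_scale q n + tensor_rat_scale q x) | m n. m \<in> N \<and> n \<in> N}"
      by (auto simp: set_mult_def F_simps cs scale_add)
    also have "\<dots> = cs (tensor_rat_scale q x)"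
    proof (intro subset_antisym subsetI)
      fix y assume "y \<in> cs (tensor_rat_scale q x)"
      then obtain m where "m \<in> N" "y = m + tensor_rat_scale q x" by (auto simp: cs)
      then show "y \<in> {m + (tensor_rat_scale q n + tensor_rat_scale q x) | m n. m \<in> N \<and> n \<in> N}"
        by (intro CollectI exI[of _ m] exI[of _ 0]) (simp add: scale_0 N0)
    qed (auto simp: cs add.assoc[symmetric] intro!: imageI N_add scale_N)
    finally show ?thesis .
  qed
  have add: "cs x \<oplus>\<^bsub>tensor_rat A\<^esub> cs y = cs (x + y)" if "x \<in> carrier F" "y \<in> carrier F" for x y
    using normal.rcos_sum[OF normN that]
    by (simp add: tensor_rat_def cs_def F_simps flip: F_def N_eq)
  have carr: "carrier (tensor_rat A) = cs ` carrier F"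
    by (simp add: tensor_rat_def carrier_FactGroup cs_def flip: F_def N_eq)
  have zero: "\<zero>\<^bsub>tensor_rat A\<^esub> = cs 0"
    by (simp add: tensor_rat_def cs flip: F_def N_eq)
  have add_F: "x + y \<in> carrier F" if "x \<in> carrier F" "y \<in> carrier F" for x y
    using F.m_closed[OF that] by (simp add: F_simps(2))
  have zero_F: "0 \<in> carrier F"
    using F.one_closed by (simp add: F_simps(3))
  have scale_plus: "tensor_rat_scale (p + q) x - (tensor_rat_scale p x + tensor_rat_scale q x) \<in> N"
    if "x \<in> carrier F" for p q x
    using that unfolding F_simps
  proof (induction rule: frag_induction)
    case zero
    then show ?case using N0 by (simp add: scale_0)
  next
    case (one y)
    then obtain a r where y: "y = (a, r)" "a \<in> carrier A" by auto
    then have "frag_of (a, p * r + q * r) - frag_of (a, p * r) - frag_of (a, q * r) \<in> N"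
      unfolding N_eq tensor_rat_relators_def by (intro generate.incl) blast
    then show ?case
      by (simp add: y scale_of distrib_right diff_diff_eq)
  next
    case (diff a b)
    from N_diff[OF diff] show ?case
      by (simp add: scale_diff algebra_simps)
  qed
  then have cs_scale_plus: "cs (tensor_rat_scale (p + q) x) = cs (tensor_rat_scale p x + tensor_rat_scale q x)"
    if "x \<in> carrier F" for p q x
    using that by (intro cs_eq)
  have scale_1: "tensor_rat_scale 1 x = x" if "x \<in> carrier F" for x
    using that unfolding F_simps
    by (induction rule: frag_induction) (auto simp: scale_0 scale_of scale_diff)
  have scale_scale: "tensor_rat_scale (p * q) x = tensor_rat_scale p (tensor_rat_scale q x)"
    if "x \<in> carrier F" for p q x
    using that unfolding F_simps
    by (induction rule: frag_induction) (auto simp: scale_0 scale_of scale_diff mult.assoc)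
  have "abelian_group (tensor_rat A)"
  proof (rule abelian_groupI)
    fix C assume "C \<in> carrier (tensor_rat A)"
    then obtain x where x: "C = cs x" "x \<in> carrier F" by (auto simp: carr)
    then have "cs (0 - x) \<oplus>\<^bsub>tensor_rat A\<^esub> C = \<zero>\<^bsub>tensor_rat A\<^esub>" "cs (0 - x) \<in> carrier (tensor_rat A)"
      using diff_F[OF zero_F x(2)] by (simp_all add: zero carr add del: diff_0)
    then show "\<exists>D\<in>carrier (tensor_rat A). D \<oplus>\<^bsub>tensor_rat A\<^esub> C = \<zero>\<^bsub>tensor_rat A\<^esub>" ..
  qed (auto simp: carr zero add add_F zero_F ac_simps intro!: imageI)
  then have "module class_ring (tensor_rat A)"
    by (intro moduleI field.axioms domain.axioms class_field)
      (auto simp: carr smult add add_F scale_F scale_add scale_scale scale_1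
        cs_scale_plus intro!: imageI)
  then show ?thesis
    by (intro vectorspace.intro class_field)
qed

text \<open>For a space that is not finite-dimensional, \<^const>\<open>vectorspace.dim\<close> is an unspecified number;
  hence the first conjunct.\<close>

definition rank_one :: "('a, 'm) monoid_scheme \<Rightarrow> bool" where
  "rank_one A \<longleftrightarrow>
     vectorspace.fin_dim class_ring (tensor_rat A) \<and> vectorspace.dim class_ring (tensor_rat A) = 1"

end

theory Submission
  imports Defs
begin

text \<open>A neighbourhood of \<open>P\<close> consists of the left orderings that keep a finite set \<open>F\<close> of
elements of \<open>P\<close> positive. Choose \<open>f > \<one>\<close> with \<open>f \<le> x\<close> for all \<open>x \<in> F\<close>. The dense ordering has
plenty of room below \<open>f\<close>, and there are three ways to use it, depending on how the elements \<open>g\<close>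
with \<open>\<one> < g \<le> f\<close> behave.

\<^item> \<^emph>\<open>Conjugation.\<close> For such \<open>g\<close> the conjugate \<open>g P g\<^sup>-\<^sup>1\<close> is a dense positive cone that still contains
\<open>F\<close>: from \<open>g \<le> x\<close> follows \<open>g\<^sup>-\<^sup>1 x g \<ge> g > \<one>\<close>. This settles the case that some \<open>g\<close> does not
normalize \<open>P\<close>.

\<^item> \<^emph>\<open>Reversal.\<close> Otherwise, multiplication on the right by elements of the interval from \<open>\<one>\<close> to
\<open>f\<close> preserves the ordering. Then the elements bounded by powers of \<open>g\<close> form a convex subgroup
\<open>H\<^sub>g\<close> on which the ordering is invariant on both sides. A convex subgroup can be given any other left
ordering while the signs of the elements outside are kept (\<open>cone_convex_replace\<close>). If \<open>f \<notin> H\<^sub>g\<close> for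
some \<open>g\<close>, then \<open>H\<^sub>g\<close> misses \<open>F\<close>, and reversing the ordering on \<open>H\<^sub>g\<close> gives the new cone.

\<^item> \<^emph>\<open>Perturbation.\<close> In the remaining case \<open>f \<in> H\<^sub>g\<close> for all \<open>g\<close>, so \<open>H = H\<^sub>f\<close> is Archimedean. By
Hoelder's theorem (\<open>holder_embedding\<close>) there is an embedding \<open>\<phi>\<close> of \<open>H\<close> into the real numbers that
induces the ordering. If all quotients \<open>\<phi> x / \<phi> f\<close> were rational, \<open>H\<close> would have rank one
(\<open>rank_one_if_commensurable\<close>), hence be isomorphic to the integers, and its ordering would not be
dense. So \<open>\<phi> a / \<phi> f\<close> is irrational for some \<open>a\<close>. Moving \<open>\<phi> a\<close> slightly along \<open>\<phi> f\<close> by a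
rational linear map of the real line gives a different dense ordering of \<open>H\<close> that keeps \<open>F \<inter> H\<close>
positive (\<open>dense_cone_near_pullback_cone\<close>).\<close>

section \<open>Positive cones and the topology on the space of left orderings\<close>

text \<open>By left invariance only the intervals \<open>(\<one>, x)\<close> have to be examined: a left ordering is dense
if and only if it has no least positive element.\<close>

lemma (in group) dense_cone_iff:
  assumes "P \<in> LO G"
  shows "dense_ordering (cone_ordering G P) \<longleftrightarrow> (\<forall>x\<in>P. \<exists>y\<in>P. inv y \<otimes> x \<in> P)"
proof
  have sub: "P \<subseteq> carrier G"
    using assms by (simp add: LO_iff)
  show "\<forall>x\<in>P. \<exists>y\<in>P. inv y \<otimes> x \<in> P" if "dense_ordering (cone_ordering G P)"
  proof
    fix x assume "x \<in> P"
    with sub have "(\<one>, x) \<in> cone_ordering G P"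
      by (auto simp: cone_ordering_def)
    with that obtain y where "(\<one>, y) \<in> cone_ordering G P" "(y, x) \<in> cone_ordering G P"
      by (auto simp: dense_ordering_def)
    then show "\<exists>y\<in>P. inv y \<otimes> x \<in> P"
      by (auto simp: cone_ordering_def)
  qed
  show "dense_ordering (cone_ordering G P)" if least: "\<forall>x\<in>P. \<exists>y\<in>P. inv y \<otimes> x \<in> P"
    unfolding dense_ordering_def
  proof (intro allI impI)
    fix g h assume "(g, h) \<in> cone_ordering G P"
    then have gh: "g \<in> carrier G" "h \<in> carrier G" "inv g \<otimes> h \<in> P"
      by (auto simp: cone_ordering_def)
    with least obtain y where y: "y \<in> P" "inv y \<otimes> (inv g \<otimes> h) \<in> P"
      by blast
    have yc: "y \<in> carrier G" using y sub by blast
    have "inv g \<otimes> (g \<otimes> y) = y" "inv (g \<otimes> y) \<otimes> h = inv y \<otimes> (inv g \<otimes> h)"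
      using gh yc by (simp_all add: m_assoc[symmetric] inv_mult_group)
    with gh y yc show "\<exists>f. (g, f) \<in> cone_ordering G P \<and> (f, h) \<in> cone_ordering G P"
      by (intro exI[of _ "g \<otimes> y"]) (simp add: cone_ordering_def)
  qed
qed

text \<open>A basic neighbourhood of \<open>P\<close> prescribes, for finitely many \<open>g\<close>, whether \<open>g\<close> is positive. Because
exactly one of \<open>g\<close> and \<open>inv g\<close> is positive when \<open>g \<noteq> \<one>\<close>, such a condition can always be
stated positively, so it is enough to keep a finite subset of \<open>P\<close>.\<close>

lemma accumulation_point_LO_I:
  fixes G :: "('a, 'm) monoid_scheme" (structure)
  assumes G: "group G" and P: "P \<in> LO G"
    and approx: "\<And>F. finite F \<Longrightarrow> F \<subseteq> P \<Longrightarrow> \<exists>Q\<in>S. Q \<in> LO G \<and> F \<subseteq> Q \<and> Q \<noteq> P"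
  shows "P \<in> LO_topology G derived_set_of S"
proof -
  interpret group G by fact
  let ?\<chi> = "\<lambda>P. \<lambda>g\<in>carrier G. g \<in> P"
  have "\<exists>Q. Q \<noteq> P \<and> Q \<in> S \<and> Q \<in> T" if PT: "P \<in> T" and T: "openin (LO_topology G) T" for T
  proof -
    obtain W where
      W: "openin (product_topology (\<lambda>_. discrete_topology (UNIV :: bool set)) (carrier G)) W"
      and TW: "T = ?\<chi> -` W \<inter> LO G"
      using T unfolding LO_topology_def openin_pullback_topology by blast
    have PW: "?\<chi> P \<in> W"
      using PT unfolding TW by simp
    obtain U where U: "finite {g \<in> carrier G. U g \<noteq> topspace (discrete_topology (UNIV :: bool set))} \<and>
        (\<forall>g\<in>carrier G. openin (discrete_topology UNIV) (U g)) \<and> ?\<chi> P \<in> Pi\<^sub>E (carrier G) U \<and> Pi\<^sub>E (carrier G) U \<subseteq> W"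
      using W[unfolded openin_product_topology_alt, rule_format, OF PW] by (rule exE)
    have PU: "?\<chi> P \<in> Pi\<^sub>E (carrier G) U" and UW: "Pi\<^sub>E (carrier G) U \<subseteq> W"
      using U by simp_all
    have fin: "finite {g \<in> carrier G. U g \<noteq> (UNIV :: bool set)}"
      using U by simp
    define F where "F = {g \<in> carrier G. U g \<noteq> UNIV}"
    \<comment> \<open>a condition \<open>g \<notin> P\<close> with \<open>g \<noteq> \<one>\<close> is the same as \<open>inv g \<in> P\<close>\<close>
    have "finite ((F \<union> m_inv G ` F) \<inter> P)"
      using fin by (simp add: F_def)
    from approx[OF this] obtain Q
      where Q: "Q \<in> S" "Q \<in> LO G" "(F \<union> m_inv G ` F) \<inter> P \<subseteq> Q" "Q \<noteq> P"
      by auto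
    have FQ: "h \<in> Q" if "g \<in> F" "h \<in> P" "h = g \<or> h = inv g" for g h
      using that Q(3) by blast
    have agree: "g \<in> Q \<longleftrightarrow> g \<in> P" if gF: "g \<in> F" for g
    proof (cases "g \<in> P \<or> g = \<one>")
      case True
      then show ?thesis
        using FQ[OF gF] LO_iff[of P] LO_iff[of Q] P Q(2) by blast
    next
      case False
      then have g: "g \<in> carrier G" "g \<noteq> \<one>" "g \<notin> P"
        using gF by (auto simp: F_def)
      then have "inv g \<in> P"
        using P LO_iff[of P] by blast
      then have "inv g \<in> Q"
        using FQ[OF gF] by blast
      then show ?thesis
        using Q(2) g LO_iff[of Q] by blast
    qed
    have "?\<chi> Q \<in> Pi\<^sub>E (carrier G) U"
    proof
      fix g assume g: "g \<in> carrier G"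
      show "?\<chi> Q g \<in> U g"
      proof (cases "g \<in> F")
        case True
        then have "?\<chi> Q g = ?\<chi> P g"
          using g agree[OF True] by simp
        moreover have "?\<chi> P g \<in> U g"
          using PU g by (rule PiE_mem)
        ultimately show ?thesis
          by simp
      qed (use g in \<open>auto simp: F_def\<close>)
    qed simp
    then have "Q \<in> T"
      using UW Q(2) unfolding TW by blast
    with Q show ?thesis
      by blast
  qed
  then show ?thesis
    using P by (auto simp: in_derived_set_of)
qed

locale left_ordered_group = group G for G (structure) +
  fixes P :: "'a set"
  assumes cone: "P \<in> LO G"
begin

abbreviation lt (infix \<open><\<^sub>P\<close> 50) where "x <\<^sub>P y \<equiv> (x, y) \<in> cone_ordering G P"
abbreviation le (infix \<open>\<le>\<^sub>P\<close> 50) where "x \<le>\<^sub>P y \<equiv> x <\<^sub>P y \<or> x = y \<and> x \<in> carrier G"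

lemma P_carrier [simp]: "x \<in> P \<Longrightarrow> x \<in> carrier G"
  and P_mult [simp]: "x \<in> P \<Longrightarrow> y \<in> P \<Longrightarrow> x \<otimes> y \<in> P"
  and one_notin_P [simp]: "\<one> \<notin> P"
  and P_or_inv: "x \<in> carrier G \<Longrightarrow> x \<noteq> \<one> \<Longrightarrow> x \<in> P \<or> inv x \<in> P"
  and P_not_inv: "x \<in> P \<Longrightarrow> inv x \<notin> P"
  using cone unfolding LO_iff by (blast, blast, blast, blast, metis in_mono)

lemma left_ordering_lt: "left_ordering G (cone_ordering G P)"
  using cone cone_ordering_positive_cone by (auto simp: LO_def)

lemma lt_iff: "x <\<^sub>P y \<longleftrightarrow> x \<in> carrier G \<and> y \<in> carrier G \<and> inv x \<otimes> y \<in> P"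
  by (auto simp: cone_ordering_def)

lemma lt_carrier: "x <\<^sub>P y \<Longrightarrow> x \<in> carrier G" "x <\<^sub>P y \<Longrightarrow> y \<in> carrier G"
  by (auto simp: lt_iff)

lemma lt_trans [trans]: "x <\<^sub>P y \<Longrightarrow> y <\<^sub>P z \<Longrightarrow> x <\<^sub>P z"
  using left_ordering_lt unfolding left_ordering_def strict_linear_order_on_def by (meson transD)

lemma lt_irrefl [simp]: "\<not> x <\<^sub>P x"
  by (auto simp: lt_iff)

lemma lt_total: "x \<in> carrier G \<Longrightarrow> y \<in> carrier G \<Longrightarrow> x <\<^sub>P y \<or> x = y \<or> y <\<^sub>P x"
  using left_ordering_lt unfolding left_ordering_def strict_linear_order_on_def total_on_def by blast

lemma lt_mult_left: "z \<in> carrier G \<Longrightarrow> x <\<^sub>P y \<Longrightarrow> z \<otimes> x <\<^sub>P z \<otimes> y"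
  using left_ordering_lt unfolding left_ordering_def by blast

lemma one_lt_iff [simp]: "\<one> <\<^sub>P x \<longleftrightarrow> x \<in> P"
  by (auto simp: lt_iff)

lemma lt_one_iff [simp]: "x <\<^sub>P \<one> \<longleftrightarrow> x \<in> carrier G \<and> inv x \<in> P"
  by (auto simp: lt_iff)

lemma le_trans [trans]:
  "x \<le>\<^sub>P y \<Longrightarrow> y \<le>\<^sub>P z \<Longrightarrow> x \<le>\<^sub>P z" "x \<le>\<^sub>P y \<Longrightarrow> y <\<^sub>P z \<Longrightarrow> x <\<^sub>P z" "x <\<^sub>P y \<Longrightarrow> y \<le>\<^sub>P z \<Longrightarrow> x <\<^sub>P z"
  using lt_trans by blast+

lemma le_mult_left: "z \<in> carrier G \<Longrightarrow> x \<le>\<^sub>P y \<Longrightarrow> z \<otimes> x \<le>\<^sub>P z \<otimes> y"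
  using lt_mult_left by auto

lemma not_le_iff: "x \<in> carrier G \<Longrightarrow> y \<in> carrier G \<Longrightarrow> \<not> x \<le>\<^sub>P y \<longleftrightarrow> y <\<^sub>P x"
  using lt_total lt_trans lt_irrefl by blast

lemma P_pow: "x \<in> P \<Longrightarrow> 0 < n \<Longrightarrow> x [^] (n::nat) \<in> P"
proof (induction n)
  case (Suc n)
  then show ?case by (cases n) auto
qed simp

text \<open>This cone belongs to the ordering in which \<open>x\<close> is below \<open>y\<close> if \<open>x \<otimes> g < y \<otimes> g\<close>: right
multiplication by \<open>g\<close> preserves left invariance.\<close>

lemma cone_conj:
  assumes g: "g \<in> carrier G"
  shows "{x \<in> carrier G. inv g \<otimes> x \<otimes> g \<in> P} \<in> LO G" (is "?Q \<in> _")
proof -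
  have mult: "inv g \<otimes> (x \<otimes> y) \<otimes> g = (inv g \<otimes> x \<otimes> g) \<otimes> (inv g \<otimes> y \<otimes> g)"
    if "x \<in> carrier G" "y \<in> carrier G" for x y
  proof -
    have "g \<otimes> (inv g \<otimes> (y \<otimes> g)) = y \<otimes> g"
      using that g by (simp add: m_assoc[symmetric])
    then show ?thesis using that g by (simp add: m_assoc)
  qed
  have inv: "inv g \<otimes> inv x \<otimes> g = inv (inv g \<otimes> x \<otimes> g)" if "x \<in> carrier G" for x
    using that g by (simp add: inv_mult_group m_assoc)
  have one: "inv g \<otimes> x \<otimes> g = \<one> \<longleftrightarrow> x = \<one>" if "x \<in> carrier G" for x
    using that g by (metis inv_closed inv_solve_left inv_solve_right' l_one m_closed r_inv)
  show ?thesis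
    unfolding LO_iff
  proof (intro conjI ballI impI)
    fix x assume "x \<in> carrier G" "x \<noteq> \<one>"
    then show "(x \<in> ?Q) \<noteq> (inv x \<in> ?Q)"
      using g one[of x] P_or_inv[of "inv g \<otimes> x \<otimes> g"] P_not_inv[of "inv g \<otimes> x \<otimes> g"]
      by (auto simp: inv)
  qed (use g mult in auto)
qed

lemma dense_cone_conj:
  assumes g: "g \<in> carrier G" and dense: "dense_ordering (cone_ordering G P)"
  shows "dense_ordering (cone_ordering G {x \<in> carrier G. inv g \<otimes> x \<otimes> g \<in> P})"
  unfolding dense_cone_iff[OF cone_conj[OF g]]
proof
  fix x assume "x \<in> {x \<in> carrier G. inv g \<otimes> x \<otimes> g \<in> P}"
  then have x: "x \<in> carrier G" "inv g \<otimes> x \<otimes> g \<in> P" by auto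
  then obtain y where y: "y \<in> P" "inv y \<otimes> (inv g \<otimes> x \<otimes> g) \<in> P"
    using dense unfolding dense_cone_iff[OF cone] by blast
  have [simp]: "inv g \<otimes> (g \<otimes> z) = z" if "z \<in> carrier G" for z
    using g that by (simp add: m_assoc[symmetric])
  have "inv g \<otimes> (g \<otimes> y \<otimes> inv g) \<otimes> g = y"
    "inv g \<otimes> (inv (g \<otimes> y \<otimes> inv g) \<otimes> x) \<otimes> g = inv y \<otimes> (inv g \<otimes> x \<otimes> g)"
    using g x y by (simp_all add: inv_mult_group m_assoc)
  then show "\<exists>y\<in>{x \<in> carrier G. inv g \<otimes> x \<otimes> g \<in> P}. inv y \<otimes> x \<in> {x \<in> carrier G. inv g \<otimes> x \<otimes> g \<in> P}"
    using g x y by (intro bexI[of _ "g \<otimes> y \<otimes> inv g"]) auto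
qed

text \<open>If \<open>g \<le> f\<close> then \<open>inv g \<otimes> f\<close> is at least \<open>\<one>\<close>, and multiplying it on the right by the
positive \<open>g\<close> gives a positive element. Hence conjugating by a small \<open>g\<close> keeps every element
above \<open>g\<close> positive.\<close>

lemma conj_small_positive:
  assumes "g \<in> P" "g \<le>\<^sub>P f"
  shows "inv g \<otimes> f \<otimes> g \<in> P"
  using assms by (auto simp: lt_iff)

text \<open>For a subgroup, containing the positive elements below each of its members amounts to the usual
two-sided notion of convexity.\<close>

definition convex :: "'a set \<Rightarrow> bool" where
  "convex H \<longleftrightarrow> (\<forall>x\<in>P. \<forall>h\<in>H. x <\<^sub>P h \<longrightarrow> x \<in> H)"

lemma convexD: "convex H \<Longrightarrow> x \<in> P \<Longrightarrow> x <\<^sub>P h \<Longrightarrow> h \<in> H \<Longrightarrow> x \<in> H"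
  by (auto simp: convex_def)

text \<open>A positive \<open>x\<close> outside a convex subgroup \<open>H\<close> lies above all of \<open>H\<close>, and so do its neighbours
modulo \<open>H\<close>.\<close>

lemma convex_absorb:
  assumes H: "subgroup H G" "convex H" and x: "x \<in> P - H" and h: "h \<in> H"
  shows "h \<otimes> x \<in> P - H" "x \<otimes> h \<in> P - H"
proof -
  interpret H: subgroup H G by fact
  have [simp]: "h \<in> carrier G" using h by auto
  have xc: "x \<in> carrier G" using x by auto
  have mem: "y \<in> H" if "k \<in> H" "y \<in> carrier G" "k \<otimes> y \<in> H \<or> y \<otimes> k \<in> H" for k y
  proof -
    have "y = inv k \<otimes> (k \<otimes> y)" "y = y \<otimes> k \<otimes> inv k"
      using that by (simp add: m_assoc[symmetric], simp add: m_assoc)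
    then show ?thesis
      using that by (metis H.m_closed H.m_inv_closed)
  qed
  have gt: "k <\<^sub>P x" if "k \<in> H" for k
    using that x lt_total[of k x] convexD[OF H(2), of x k] by auto
  have "inv h <\<^sub>P x"
    using gt H.m_inv_closed h by blast
  then have "h \<otimes> x \<in> P"
    by (simp add: lt_iff)
  moreover have "x \<otimes> h \<in> P"
  proof (rule ccontr)
    \<comment> \<open>otherwise \<open>inv h \<otimes> inv x\<close> lies between \<open>\<one>\<close> and \<open>inv h\<close>\<close>
    assume "x \<otimes> h \<notin> P"
    moreover have "x \<otimes> h \<noteq> \<one>"
      using x xc h by (metis DiffD2 H.m_inv_closed inv_equality inv_inv \<open>h \<in> carrier G\<close>)
    ultimately have "inv h \<otimes> inv x \<in> P"
      using P_or_inv[of "x \<otimes> h"] xc by (simp add: inv_mult_group)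
    moreover have "inv h \<otimes> inv x <\<^sub>P inv h"
      using lt_mult_left[of "inv h" "inv x" \<one>] x xc by simp
    ultimately have "inv h \<otimes> inv x \<in> H"
      using convexD[OF H(2)] h by blast
    then have "inv x \<in> H"
      using mem h xc H.m_inv_closed inv_closed by blast
    then have "x \<in> H"
      using H.m_inv_closed[of "inv x"] xc by simp
    with x show False by simp
  qed
  moreover have "h \<otimes> x \<notin> H" "x \<otimes> h \<notin> H"
    using mem[OF h xc] x by blast+
  ultimately show "h \<otimes> x \<in> P - H" "x \<otimes> h \<in> P - H"
    by blast+
qed

end

section \<open>Changing an ordering on a convex subgroup\<close>

lemma (in group) LO_subgroup_iff:
  assumes "subgroup H G"
  shows "Q \<in> LO (G\<lparr>carrier := H\<rparr>) \<longleftrightarrow> Q \<subseteq> H \<and> (\<forall>g\<in>Q. \<forall>h\<in>Q. g \<otimes> h \<in> Q) \<and>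
     \<one> \<notin> Q \<and> (\<forall>g\<in>H. g \<noteq> \<one> \<longrightarrow> (g \<in> Q) \<noteq> (inv g \<in> Q))"
  using group.LO_iff[OF subgroup_imp_group[OF assms], of Q] m_inv_consistent[OF assms]
  by simp

lemma (in group) cone_ordering_subgroup:
  assumes "subgroup H G"
  shows "cone_ordering (G\<lparr>carrier := H\<rparr>) (P \<inter> H) = cone_ordering G P \<inter> H \<times> H"
proof -
  interpret H: subgroup H G by fact
  have "inv\<^bsub>G\<lparr>carrier := H\<rparr>\<^esub> x \<otimes> y \<in> P \<inter> H \<longleftrightarrow> inv x \<otimes> y \<in> P" if "x \<in> H" "y \<in> H" for x y
    using that m_inv_consistent[OF assms that(1)] by simp
  then show ?thesis
    using H.subset by (auto simp: cone_ordering_def)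
qed

lemma (in group) dense_subgroup_iff:
  assumes H: "subgroup H G" and Q: "Q \<in> LO (G\<lparr>carrier := H\<rparr>)"
  shows "dense_ordering (cone_ordering (G\<lparr>carrier := H\<rparr>) Q) \<longleftrightarrow> (\<forall>x\<in>Q. \<exists>y\<in>Q. inv y \<otimes> x \<in> Q)"
proof -
  have "Q \<subseteq> H"
    using Q unfolding LO_subgroup_iff[OF H] by blast
  then have "inv\<^bsub>G\<lparr>carrier := H\<rparr>\<^esub> y = inv y" if "y \<in> Q" for y
    using m_inv_consistent[OF H] that by blast
  then show ?thesis
    using group.dense_cone_iff[OF subgroup_imp_group[OF H] Q] by simp
qed

context left_ordered_group
begin

context
  fixes H
  assumes H: "subgroup H G" and convex: "convex H"
begin

interpretation H: subgroup H G by (fact H)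

text \<open>The sign of an element outside \<open>H\<close> depends only on its coset on either side of \<open>H\<close>, by
\<open>convex_absorb\<close>. Therefore any left ordering of \<open>H\<close> may be used inside \<open>H\<close> without disturbing
the ordering outside.\<close>

lemma cone_convex_replace:
  assumes Q: "Q \<in> LO (G\<lparr>carrier := H\<rparr>)"
  shows "Q \<union> (P - H) \<in> LO G"
proof -
  have QH: "Q \<subseteq> H" and Qm: "\<And>g h. g \<in> Q \<Longrightarrow> h \<in> Q \<Longrightarrow> g \<otimes> h \<in> Q" and Q1: "\<one> \<notin> Q"
    and Qt: "\<And>g. g \<in> H \<Longrightarrow> g \<noteq> \<one> \<Longrightarrow> (g \<in> Q) \<noteq> (inv g \<in> Q)"
    using Q unfolding LO_subgroup_iff[OF H] by blast+
  have PP: "x \<otimes> y \<in> P - H" if "x \<in> P - H" "y \<in> P - H" for x y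
  proof -
    have "x <\<^sub>P x \<otimes> y"
      using lt_mult_left[of x \<one> y] that by simp
    then show ?thesis
      using convexD[OF convex, of x "x \<otimes> y"] that by auto
  qed
  have "(g \<in> Q \<union> (P - H)) \<noteq> (inv g \<in> Q \<union> (P - H))" if g: "g \<in> carrier G" "g \<noteq> \<one>" for g
  proof (cases "g \<in> H")
    case True
    then show ?thesis using Qt[of g] g H.m_inv_closed[OF True] by blast
  next
    case False
    then have "inv g \<notin> H"
      using H.m_inv_closed[of "inv g"] g by auto
    then show ?thesis
      using False QH P_or_inv[OF g] P_not_inv[of g] by blast
  qed
  moreover have "g \<otimes> h \<in> Q \<union> (P - H)" if "g \<in> Q \<union> (P - H)" "h \<in> Q \<union> (P - H)" for g h
  proof -
    have "x \<otimes> y \<in> P - H" if "x \<in> Q" "y \<in> P - H" for x y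
      by (rule convex_absorb(1)[OF H convex that(2) subsetD[OF QH that(1)]])
    moreover have "x \<otimes> y \<in> P - H" if "x \<in> P - H" "y \<in> Q" for x y
      by (rule convex_absorb(2)[OF H convex that(1) subsetD[OF QH that(2)]])
    ultimately show ?thesis
      using that Qm PP by (metis Un_iff)
  qed
  moreover have "Q \<union> (P - H) \<subseteq> carrier G"
    using QH H.subset P_carrier by blast
  moreover have "\<one> \<notin> Q \<union> (P - H)"
    using Q1 by simp
  ultimately show ?thesis
    unfolding LO_iff by blast
qed

text \<open>The elements of \<open>Q\<close> lie below every positive element
outside \<open>H\<close>; so a least positive element could only come from \<open>Q\<close>.\<close>

lemma dense_convex_replace:
  assumes Q: "Q \<in> LO (G\<lparr>carrier := H\<rparr>)"
    and dense: "dense_ordering (cone_ordering (G\<lparr>carrier := H\<rparr>) Q)" and ne: "Q \<noteq> {}"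
  shows "dense_ordering (cone_ordering G (Q \<union> (P - H)))"
  unfolding dense_cone_iff[OF cone_convex_replace[OF Q]]
proof
  have QH: "Q \<subseteq> H"
    using Q unfolding LO_subgroup_iff[OF H] by blast
  fix x assume "x \<in> Q \<union> (P - H)"
  then consider "x \<in> Q" | "x \<in> P - H"
    by blast
  then show "\<exists>y\<in>Q \<union> (P - H). inv y \<otimes> x \<in> Q \<union> (P - H)"
  proof cases
    case 1
    then show ?thesis
      using dense unfolding dense_subgroup_iff[OF H Q] by blast
  next
    case 2
    obtain y where "y \<in> Q"
      using ne by blast
    then show ?thesis
      using convex_absorb(1)[OF H convex 2, of "inv y"] QH H.m_inv_closed by blast
  qed
qed

lemma cone_convex_restrict: "P \<inter> H \<in> LO (G\<lparr>carrier := H\<rparr>)"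
proof -
  have "(g \<in> P \<inter> H) \<noteq> (inv g \<in> P \<inter> H)" if "g \<in> H" "g \<noteq> \<one>" for g
    using that P_or_inv[of g] P_not_inv[of g] H.m_inv_closed[of g] H.mem_carrier[of g] by blast
  then have "\<forall>g\<in>H. g \<noteq> \<one> \<longrightarrow> (g \<in> P \<inter> H) \<noteq> (inv g \<in> P \<inter> H)"
    by blast
  moreover have "\<forall>g\<in>P \<inter> H. \<forall>h\<in>P \<inter> H. g \<otimes> h \<in> P \<inter> H" "\<one> \<notin> P \<inter> H" "P \<inter> H \<subseteq> H"
    by simp_all
  ultimately show ?thesis
    unfolding LO_subgroup_iff[OF H] by (intro conjI)
qed

lemma dense_convex_restrict:
  assumes dense: "dense_ordering (cone_ordering G P)"
  shows "dense_ordering (cone_ordering (G\<lparr>carrier := H\<rparr>) (P \<inter> H))"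
  unfolding dense_subgroup_iff[OF H cone_convex_restrict]
proof
  fix x assume x: "x \<in> P \<inter> H"
  then obtain y where y: "y \<in> P" "inv y \<otimes> x \<in> P"
    using dense unfolding dense_cone_iff[OF cone] by blast
  then have "y <\<^sub>P x"
    using x by (simp add: lt_iff)
  then have "y \<in> H"
    using convexD[OF convex] x y by blast
  then show "\<exists>y\<in>P \<inter> H. inv y \<otimes> x \<in> P \<inter> H"
    using x y H.m_inv_closed H.m_closed by blast
qed

lemma cone_reverse: "{x \<in> H. inv x \<in> P} \<in> LO (G\<lparr>carrier := H\<rparr>)"
proof -
  have "inv (x \<otimes> y) \<in> P" if "x \<in> H" "y \<in> H" "inv x \<in> P" "inv y \<in> P" for x y
    using that by (simp add: inv_mult_group)
  moreover have "(inv g \<in> P) \<noteq> (inv (inv g) \<in> P)" if "g \<in> H" "g \<noteq> \<one>" for g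
    using that P_or_inv[of g] P_not_inv[of g] H.mem_carrier[of g] inv_inv[of g] by metis
  ultimately show ?thesis
    unfolding LO_subgroup_iff[OF H] using H.m_closed H.m_inv_closed by simp
qed

lemma dense_reverse:
  assumes dense: "dense_ordering (cone_ordering (G\<lparr>carrier := H\<rparr>) (P \<inter> H))"
  shows "dense_ordering (cone_ordering (G\<lparr>carrier := H\<rparr>) {x \<in> H. inv x \<in> P})"
  unfolding dense_subgroup_iff[OF H cone_reverse]
proof
  fix x assume "x \<in> {x \<in> H. inv x \<in> P}"
  then have x: "x \<in> H" "inv x \<in> P \<inter> H"
    by auto
  then obtain y where y: "y \<in> P \<inter> H" "inv y \<otimes> inv x \<in> P \<inter> H"
    using dense unfolding dense_subgroup_iff[OF H cone_convex_restrict] by blast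
  have yc: "y \<in> carrier G" "y \<in> H" and xc: "x \<in> carrier G"
    using x y by auto
  have "inv (inv (x \<otimes> y) \<otimes> x) = inv x \<otimes> (x \<otimes> y)"
    using xc yc by (simp add: inv_mult_group)
  also have "\<dots> = y"
    using xc yc by (simp add: m_assoc[symmetric])
  finally have "inv (inv (x \<otimes> y) \<otimes> x) \<in> P"
    using y by simp
  moreover have "inv (x \<otimes> y) \<in> P"
    using xc yc y by (simp add: inv_mult_group)
  ultimately show "\<exists>y\<in>{x \<in> H. inv x \<in> P}. inv y \<otimes> x \<in> {x \<in> H. inv x \<in> P}"
    using x yc H.m_closed H.m_inv_closed by blast
qed

end

end

section \<open>Two-sided invariance near the identity\<close>

locale bi_ordered_group = left_ordered_group +
  assumes P_conj: "x \<in> carrier G \<Longrightarrow> p \<in> P \<Longrightarrow> x \<otimes> p \<otimes> inv x \<in> P"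
begin

lemma lt_mult_right:
  assumes z: "z \<in> carrier G" and "x <\<^sub>P y"
  shows "x \<otimes> z <\<^sub>P y \<otimes> z"
proof -
  have xy: "x \<in> carrier G" "y \<in> carrier G" "inv x \<otimes> y \<in> P"
    using assms by (auto simp: lt_iff)
  have "inv (x \<otimes> z) \<otimes> (y \<otimes> z) = inv z \<otimes> (inv x \<otimes> y) \<otimes> inv (inv z)"
    using z xy by (simp add: inv_mult_group m_assoc)
  then show ?thesis
    using P_conj[of "inv z" "inv x \<otimes> y"] z xy by (simp add: lt_iff)
qed

lemma le_mult_right: "z \<in> carrier G \<Longrightarrow> x \<le>\<^sub>P y \<Longrightarrow> x \<otimes> z \<le>\<^sub>P y \<otimes> z"
  using lt_mult_right by auto

lemma le_mult: 
  assumes "x \<le>\<^sub>P y" "u \<le>\<^sub>P v"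
  shows "x \<otimes> u \<le>\<^sub>P y \<otimes> v"
proof -
  have "x \<otimes> u \<le>\<^sub>P y \<otimes> u"
    using assms lt_carrier by (intro le_mult_right) blast+
  also have "y \<otimes> u \<le>\<^sub>P y \<otimes> v"
    using assms lt_carrier by (intro le_mult_left) blast+
  finally show ?thesis .
qed

lemma lt_mult:
  assumes "x <\<^sub>P y" "u <\<^sub>P v"
  shows "x \<otimes> u <\<^sub>P y \<otimes> v"
proof -
  have "x \<otimes> u <\<^sub>P y \<otimes> u"
    using assms lt_carrier by (intro lt_mult_right) blast+
  also have "y \<otimes> u <\<^sub>P y \<otimes> v"
    using assms lt_carrier by (intro lt_mult_left) blast+
  finally show ?thesis .
qed

lemma le_pow:
  assumes "x \<le>\<^sub>P y"
  shows "x [^] (n::nat) \<le>\<^sub>P y [^] n"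
proof (induction n)
  case (Suc n)
  show ?case
    using le_mult[OF Suc assms] by (simp only: nat_pow_Suc)
qed simp

end

context left_ordered_group
begin

text \<open>The normalizer of the cone \<open>P\<close> under conjugation. Elements outside of it give new orderings by
conjugation; on a subgroup contained in it, the ordering is invariant on both sides.\<close>

definition normalizer :: "'a set" where
  "normalizer = {g \<in> carrier G. \<forall>x\<in>carrier G. inv g \<otimes> x \<otimes> g \<in> P \<longleftrightarrow> x \<in> P}"

lemma normalizerD:
  "g \<in> normalizer \<Longrightarrow> g \<in> carrier G"
  "g \<in> normalizer \<Longrightarrow> x \<in> carrier G \<Longrightarrow> inv g \<otimes> x \<otimes> g \<in> P \<longleftrightarrow> x \<in> P"
  by (auto simp: normalizer_def)

lemma normalizer_conj:
  assumes "g \<in> normalizer" "p \<in> P"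
  shows "g \<otimes> p \<otimes> inv g \<in> P"
proof -
  have g: "g \<in> carrier G" and p: "p \<in> carrier G"
    using assms by (auto simp: normalizer_def)
  then have "inv g \<otimes> (g \<otimes> p \<otimes> inv g) \<otimes> g = (inv g \<otimes> g) \<otimes> p \<otimes> (inv g \<otimes> g)"
    by (simp only: m_assoc m_closed inv_closed)
  with g p assms show ?thesis
    using normalizerD(2)[of g "g \<otimes> p \<otimes> inv g"] by simp
qed

lemma normalizer_mult:
  assumes "g \<in> normalizer" "h \<in> normalizer"
  shows "g \<otimes> h \<in> normalizer"
proof -
  have c: "g \<in> carrier G" "h \<in> carrier G"
    using assms normalizerD by blast+
  have "inv (g \<otimes> h) \<otimes> x \<otimes> (g \<otimes> h) \<in> P \<longleftrightarrow> x \<in> P" if x: "x \<in> carrier G" for x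
  proof -
    have "inv (g \<otimes> h) \<otimes> x \<otimes> (g \<otimes> h) = inv h \<otimes> (inv g \<otimes> x \<otimes> g) \<otimes> h"
      using c x by (simp add: inv_mult_group m_assoc)
    then show ?thesis
      using normalizerD(2)[OF assms(1) x] normalizerD(2)[OF assms(2), of "inv g \<otimes> x \<otimes> g"] c x by simp
  qed
  then show ?thesis
    using c by (simp add: normalizer_def)
qed

lemma normalizer_inv:
  assumes "g \<in> normalizer"
  shows "inv g \<in> normalizer"
proof -
  have c: "g \<in> carrier G"
    using assms normalizerD by blast
  have "inv (inv g) \<otimes> x \<otimes> inv g \<in> P \<longleftrightarrow> x \<in> P" if x: "x \<in> carrier G" for x
  proof -
    have "inv g \<otimes> (g \<otimes> x \<otimes> inv g) \<otimes> g = (inv g \<otimes> g) \<otimes> x \<otimes> (inv g \<otimes> g)"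
      using c x by (simp only: m_assoc m_closed inv_closed)
    then show ?thesis
      using normalizerD(2)[OF assms, of "g \<otimes> x \<otimes> inv g"] c x by simp
  qed
  then show ?thesis
    using c by (simp add: normalizer_def)
qed

text \<open>Right multiplication by \<open>z\<close> preserves the ordering exactly when \<open>z\<close> normalizes the cone.\<close>

lemma normalizer_le_mult_right:
  assumes z: "z \<in> normalizer" and xy: "x \<le>\<^sub>P y"
  shows "x \<otimes> z \<le>\<^sub>P y \<otimes> z"
proof (cases "x = y")
  case True
  then show ?thesis using assms normalizerD(1) lt_carrier by auto
next
  case False
  then have c: "x \<in> carrier G" "y \<in> carrier G" "inv x \<otimes> y \<in> P" "z \<in> carrier G"
    using xy normalizerD(1)[OF z] by (auto simp: lt_iff)
  have "inv (x \<otimes> z) \<otimes> (y \<otimes> z) = inv z \<otimes> (inv x \<otimes> y) \<otimes> z"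
    using c by (simp add: inv_mult_group m_assoc)
  then show ?thesis
    using normalizerD(2)[OF z, of "inv x \<otimes> y"] c by (simp add: lt_iff)
qed

text \<open>For a positive \<open>f\<close> whose powers normalize the cone, this is the smallest convex subgroup that
contains \<open>f\<close>.\<close>

definition cyclic_hull :: "'a \<Rightarrow> 'a set" where
  "cyclic_hull f = {x \<in> carrier G. \<exists>n::nat. x \<le>\<^sub>P f [^] n \<and> inv x \<le>\<^sub>P f [^] n}"

context
  fixes f
  assumes f [simp]: "f \<in> P"
begin

lemma pow_mono_exp:
  assumes "m \<le> (n::nat)"
  shows "f [^] m \<le>\<^sub>P f [^] n"
proof (cases "m = n")
  case False
  then have "f [^] (n - m) \<in> P"
    using assms f by (intro P_pow) auto
  then have "f [^] m \<otimes> \<one> <\<^sub>P f [^] m \<otimes> f [^] (n - m)"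
    by (intro lt_mult_left) auto
  then show ?thesis
    using assms by (simp add: nat_pow_mult)
qed simp

lemma self_in_cyclic_hull: "f \<in> cyclic_hull f"
proof -
  have "inv f <\<^sub>P \<one>" "\<one> <\<^sub>P f"
    using f by simp_all
  then have "inv f <\<^sub>P f"
    by (rule lt_trans)
  then have "f \<le>\<^sub>P f [^] (1::nat) \<and> inv f \<le>\<^sub>P f [^] (1::nat)"
    by simp
  then show ?thesis
    using P_carrier[OF f] unfolding cyclic_hull_def by blast
qed

lemma convex_cyclic_hull: "convex (cyclic_hull f)"
  unfolding convex_def
proof (intro ballI impI)
  fix x h assume x: "x \<in> P" and "h \<in> cyclic_hull f" and xh: "x <\<^sub>P h"
  then obtain n :: nat where n: "h \<le>\<^sub>P f [^] n"
    unfolding cyclic_hull_def by blast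
  have "x \<le>\<^sub>P f [^] n"
    using xh n le_trans by blast
  moreover have "inv x <\<^sub>P \<one>"
    using x by simp
  then have "inv x \<le>\<^sub>P f [^] n"
    using le_trans(3)[OF _ pow_mono_exp[of 0 n]] by simp
  ultimately show "x \<in> cyclic_hull f"
    using x unfolding cyclic_hull_def by auto
qed

context
  assumes small: "\<And>g. g \<in> P \<Longrightarrow> g \<le>\<^sub>P f \<Longrightarrow> g \<in> normalizer"
begin

text \<open>An element above \<open>f\<close> and at most \<open>f [^] Suc n\<close> is \<open>f\<close> times a positive element that is at most
\<open>f [^] n\<close>. So normalization by the elements of the interval from \<open>\<one>\<close> to \<open>f\<close> spreads to
everything below a power of \<open>f\<close>.\<close>

lemma below_pow_normalizer: "x \<in> P \<Longrightarrow> x \<le>\<^sub>P f [^] (n::nat) \<Longrightarrow> x \<in> normalizer"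
proof (induction n arbitrary: x)
  case 0
  then have "x <\<^sub>P \<one> \<or> x = \<one>" by auto
  then show ?case
    using 0(1) P_not_inv by auto
next
  case (Suc n)
  have xc: "x \<in> carrier G" using Suc.prems by simp
  show ?case
  proof (cases "x \<le>\<^sub>P f")
    case True
    then show ?thesis using small Suc.prems by blast
  next
    case False
    then have "f <\<^sub>P x"
      using not_le_iff[OF xc P_carrier[OF f]] by blast
    then have pos: "inv f \<otimes> x \<in> P"
      by (simp add: lt_iff)
    have fn: "inv f \<otimes> f [^] Suc n = f [^] n"
      using nat_pow_Suc2[of f n] by (simp add: m_assoc[symmetric])
    have "inv f \<otimes> x \<le>\<^sub>P inv f \<otimes> f [^] Suc n"
      using Suc.prems(2) by (intro le_mult_left) auto
    then have "inv f \<otimes> x \<in> normalizer"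
      using Suc.IH[OF pos] unfolding fn by blast
    moreover have "f \<in> normalizer"
      using small[OF f] by simp
    ultimately have "f \<otimes> (inv f \<otimes> x) \<in> normalizer"
      by (metis normalizer_mult)
    then show ?thesis
      using xc by (simp add: m_assoc[symmetric])
  qed
qed

lemma cyclic_hull_subset_normalizer: "cyclic_hull f \<subseteq> normalizer"
proof
  fix x assume "x \<in> cyclic_hull f"
  then obtain n :: nat where x: "x \<in> carrier G" "x \<le>\<^sub>P f [^] n" "inv x \<le>\<^sub>P f [^] n"
    unfolding cyclic_hull_def by blast
  consider "x = \<one>" | "x \<in> P" | "inv x \<in> P"
    using P_or_inv x(1) by blast
  then show "x \<in> normalizer"
  proof cases
    case 1
    then show ?thesis by (simp add: normalizer_def)
  next
    case 2
    then show ?thesis using below_pow_normalizer x by blast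
  next
    case 3
    then have "inv x \<in> normalizer"
      using below_pow_normalizer x by blast
    then have "inv (inv x) \<in> normalizer"
      by (rule normalizer_inv)
    then show ?thesis using x by simp
  qed
qed

text \<open>Multiplying \<open>x \<le> f [^] m\<close> and \<open>y \<le> f [^] n\<close> requires invariance on the right, which holds
because the powers of \<open>f\<close> normalize the cone.\<close>

lemma subgroup_cyclic_hull: "subgroup (cyclic_hull f) G"
proof
  show "cyclic_hull f \<subseteq> carrier G"
    by (auto simp: cyclic_hull_def)
  show "\<one> \<in> cyclic_hull f"
    unfolding cyclic_hull_def by (auto intro!: exI[of _ "0::nat"])
  show "inv x \<in> cyclic_hull f" if "x \<in> cyclic_hull f" for x
    using that unfolding cyclic_hull_def by auto
  have powN: "f [^] (n::nat) \<in> normalizer" for n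
  proof (cases "n = 0")
    case False
    then show ?thesis
      using below_pow_normalizer[of "f [^] n" n] P_pow[OF f] by simp
  qed (simp add: normalizer_def)
  have le: "x \<otimes> y \<le>\<^sub>P f [^] (m + n)" if "x \<le>\<^sub>P f [^] (m::nat)" "y \<le>\<^sub>P f [^] (n::nat)" "x \<in> carrier G" for x y m n
  proof -
    have "x \<otimes> y \<le>\<^sub>P x \<otimes> f [^] n"
      using that by (intro le_mult_left)
    also have "x \<otimes> f [^] n \<le>\<^sub>P f [^] m \<otimes> f [^] n"
      using that powN by (intro normalizer_le_mult_right)
    finally show ?thesis
      by (simp add: nat_pow_mult)
  qed
  fix x y assume "x \<in> cyclic_hull f" "y \<in> cyclic_hull f"
  then obtain m n :: nat where xy: "x \<in> carrier G" "y \<in> carrier G" "x \<le>\<^sub>P f [^] m"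
      "inv x \<le>\<^sub>P f [^] m" "y \<le>\<^sub>P f [^] n" "inv y \<le>\<^sub>P f [^] n"
    unfolding cyclic_hull_def by blast
  have "x \<otimes> y \<le>\<^sub>P f [^] (m + n)"
    using xy by (intro le)
  moreover have "inv y \<otimes> inv x \<le>\<^sub>P f [^] (n + m)"
    using xy by (intro le) auto
  ultimately show "x \<otimes> y \<in> cyclic_hull f"
    using xy unfolding cyclic_hull_def by (auto simp: inv_mult_group add.commute intro!: exI[of _ "m + n"])
qed

lemma bi_ordered_cyclic_hull: "bi_ordered_group (G\<lparr>carrier := cyclic_hull f\<rparr>) (P \<inter> cyclic_hull f)"
proof -
  interpret H: subgroup "cyclic_hull f" G by (rule subgroup_cyclic_hull)
  interpret HG: group "G\<lparr>carrier := cyclic_hull f\<rparr>" using subgroup_cyclic_hull by (rule subgroup_imp_group)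
  show ?thesis
  proof
    show "P \<inter> cyclic_hull f \<in> LO (G\<lparr>carrier := cyclic_hull f\<rparr>)"
      using subgroup_cyclic_hull convex_cyclic_hull by (rule cone_convex_restrict)
    fix x p assume "x \<in> carrier (G\<lparr>carrier := cyclic_hull f\<rparr>)" "p \<in> P \<inter> cyclic_hull f"
    then have xp: "x \<in> cyclic_hull f" "p \<in> P" "p \<in> cyclic_hull f"
      by auto
    have "x \<otimes> p \<otimes> inv x \<in> P"
      using xp cyclic_hull_subset_normalizer by (intro normalizer_conj) blast+
    moreover have "x \<otimes> p \<otimes> inv x \<in> cyclic_hull f"
      using xp by (intro H.m_closed H.m_inv_closed)
    ultimately show "x \<otimes>\<^bsub>G\<lparr>carrier := cyclic_hull f\<rparr>\<^esub> p \<otimes>\<^bsub>G\<lparr>carrier := cyclic_hull f\<rparr>\<^esub> inv\<^bsub>G\<lparr>carrier := cyclic_hull f\<rparr>\<^esub> x \<in> P \<inter> cyclic_hull f"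
      using m_inv_consistent[OF subgroup_cyclic_hull xp(1)] by simp
  qed
qed

end

end

end

section \<open>The embedding theorem of Hoelder\<close>

text \<open>The slope is the supremum of all \<open>a q / q\<close>. Comparing \<open>a (q * p)\<close> with \<open>p * a q\<close> and with
\<open>q * a p\<close> gives \<open>a q / q \<le> (a p + 1) / p\<close> for all \<open>p\<close> and \<open>q\<close>, whence both bounds.\<close>

lemma almost_homogeneous_slope:
  fixes a :: "nat \<Rightarrow> int"
  assumes lower: "\<And>p q. 0 < p \<Longrightarrow> 0 < q \<Longrightarrow> int p * a q \<le> a (q * p)"
    and upper: "\<And>p q. 0 < p \<Longrightarrow> 0 < q \<Longrightarrow> a (q * p) \<le> int p * a q + int p"
  shows "\<exists>r::real. \<forall>q>0. a q \<le> q * r \<and> q * r \<le> a q + 1"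
proof -
  have le: "a q / q \<le> (a p + 1) / p" if "0 < p" "0 < q" for p q :: nat
  proof -
    have "int p * a q \<le> int q * a p + int q"
      using lower[OF that] upper[OF that(2,1)] by (simp add: mult.commute)
    then have "real_of_int (int p * a q) \<le> real_of_int (int q * a p + int q)"
      by (simp only: of_int_le_iff)
    then show ?thesis
      using that by (simp add: field_simps)
  qed
  define S where "S = (\<lambda>q. a q / real q) ` {0<..}"
  define r where "r = Sup S"
  have bdd: "bdd_above S"
    unfolding S_def using le[of 1] by (intro bdd_aboveI2[of _ _ "(a 1 + 1) / real 1"]) auto
  have "a q \<le> q * r \<and> q * r \<le> a q + 1" if q: "0 < q" for q
  proof
    have "a q / q \<le> r"
      unfolding r_def using q bdd by (intro cSup_upper) (auto simp: S_def)
    then show "a q \<le> q * r"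
      using q by (simp add: field_simps)
    have "r \<le> (a q + 1) / q"
      unfolding r_def using q le[OF q] by (intro cSup_least) (auto simp: S_def)
    then show "q * r \<le> a q + 1"
      using q by (simp add: field_simps)
  qed
  then show ?thesis by blast
qed

lemma (in group) pow_shift:
  assumes "x \<in> carrier G" "y \<in> carrier G"
  shows "x \<otimes> (y \<otimes> x) [^] (n::nat) = (x \<otimes> y) [^] n \<otimes> x"
proof (induction n)
  case (Suc n)
  have "x \<otimes> (y \<otimes> x) [^] Suc n = (x \<otimes> (y \<otimes> x) [^] n) \<otimes> (y \<otimes> x)"
    using assms by (simp add: m_assoc)
  also have "\<dots> = (x \<otimes> y) [^] Suc n \<otimes> x"
    unfolding Suc using assms by (simp add: m_assoc)
  finally show ?case .
qed (use assms in simp)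

context bi_ordered_group
begin

text \<open>Replacing one factor \<open>x \<otimes> y\<close> of a product by \<open>y \<otimes> x\<close> makes the product larger, and
\<open>x [^] n \<otimes> y [^] n\<close>, \<open>(x \<otimes> y) [^] n\<close> and \<open>y [^] n \<otimes> x [^] n\<close> arise from each other
by such replacements. These bounds make the embedding additive before the group is known to be
commutative.\<close>

lemma pow_mult_bounds:
  assumes c: "x \<in> carrier G" "y \<in> carrier G" and le: "x \<otimes> y \<le>\<^sub>P y \<otimes> x"
  shows "x [^] (n::nat) \<otimes> y [^] n \<le>\<^sub>P (x \<otimes> y) [^] n"
    and "(x \<otimes> y) [^] n \<le>\<^sub>P (y \<otimes> x) [^] n"
    and "(y \<otimes> x) [^] n \<le>\<^sub>P y [^] n \<otimes> x [^] n"
proof -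
  show mid: "(x \<otimes> y) [^] n \<le>\<^sub>P (y \<otimes> x) [^] n" for n :: nat
    using le by (rule le_pow)
  have mono: "u \<otimes> v \<otimes> w \<le>\<^sub>P u \<otimes> v' \<otimes> w"
    if "u \<in> carrier G" "w \<in> carrier G" "v \<le>\<^sub>P v'" for u v v' w
    using that by (intro le_mult_left le_mult_right)
  have step: "u \<otimes> (v \<otimes> u) [^] n \<otimes> v = (u \<otimes> v) [^] Suc n"
    "u [^] Suc n \<otimes> v [^] Suc n = u \<otimes> (u [^] n \<otimes> v [^] n) \<otimes> v"
    if "u \<in> carrier G" "v \<in> carrier G" for u v n
  proof -
    show "u \<otimes> (v \<otimes> u) [^] n \<otimes> v = (u \<otimes> v) [^] Suc n"
      using pow_shift[of u v n] that by (simp add: m_assoc)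
    show "u [^] Suc n \<otimes> v [^] Suc n = u \<otimes> (u [^] n \<otimes> v [^] n) \<otimes> v"
      using nat_pow_Suc2[of u n] nat_pow_Suc[of v n] that by (simp add: m_assoc del: nat_pow_Suc)
  qed
  show "x [^] n \<otimes> y [^] n \<le>\<^sub>P (x \<otimes> y) [^] n"
  proof (induction n)
    case (Suc n)
    have "x [^] Suc n \<otimes> y [^] Suc n \<le>\<^sub>P x \<otimes> (x \<otimes> y) [^] n \<otimes> y"
      unfolding step(2)[OF c] by (rule mono[OF c Suc])
    also have "x \<otimes> (x \<otimes> y) [^] n \<otimes> y \<le>\<^sub>P x \<otimes> (y \<otimes> x) [^] n \<otimes> y"
      by (rule mono[OF c mid])
    finally show ?case
      unfolding step(1)[OF c] .
  qed simp
  show "(y \<otimes> x) [^] n \<le>\<^sub>P y [^] n \<otimes> x [^] n"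
  proof (induction n)
    case (Suc n)
    have "(y \<otimes> x) [^] Suc n \<le>\<^sub>P y \<otimes> (y \<otimes> x) [^] n \<otimes> x"
      unfolding step(1)[OF c(2,1), symmetric] by (rule mono[OF c(2,1) mid])
    also have "y \<otimes> (y \<otimes> x) [^] n \<otimes> x \<le>\<^sub>P y \<otimes> (y [^] n \<otimes> x [^] n) \<otimes> x"
      by (rule mono[OF c(2,1) Suc])
    finally show ?case
      unfolding step(2)[OF c(2,1)] .
  qed simp
qed

context
  fixes f
  assumes f [simp]: "f \<in> P"
begin

lemma int_pow_strict_mono:
  assumes "i < (j::int)"
  shows "f [^] i <\<^sub>P f [^] j"
proof -
  have "f [^] (j - i) = f [^] nat (j - i)"
    using assms int_pow_int[of G f "nat (j - i)"] by simp
  then have "f [^] (j - i) \<in> P"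
    using P_pow[OF f, of "nat (j - i)"] assms by simp
  then have "f [^] i \<otimes> \<one> <\<^sub>P f [^] i \<otimes> f [^] (j - i)"
    by (intro lt_mult_left) auto
  then show ?thesis
    by (simp flip: int_pow_mult)
qed

lemma int_pow_le_iff: "f [^] i \<le>\<^sub>P f [^] j \<longleftrightarrow> i \<le> (j::int)"
proof (cases "i \<le> j")
  case True
  then show ?thesis
    using int_pow_strict_mono[of i j] by (cases "i = j") auto
next
  case False
  then show ?thesis
    using int_pow_strict_mono[of j i] not_le_iff[of "f [^] i" "f [^] j"] by simp
qed

context
  assumes archimedean: "\<And>x. x \<in> P \<Longrightarrow> \<exists>n::nat. x <\<^sub>P f [^] n"
begin

lemma int_pow_bracket:
  assumes x: "x \<in> carrier G"
  shows "\<exists>k::int. f [^] k \<le>\<^sub>P x \<and> x <\<^sub>P f [^] (k + 1)"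
proof -
  have bound: "\<exists>n::nat. y <\<^sub>P f [^] n" if y: "y \<in> carrier G" for y
  proof (cases "y \<in> P")
    case True
    then show ?thesis by (rule archimedean)
  next
    case False
    then have "y \<le>\<^sub>P \<one>"
      using y P_or_inv by auto
    then have "y <\<^sub>P f [^] (1::nat)"
      using le_trans(2)[of y \<one> f] f by simp
    then show ?thesis ..
  qed
  obtain n :: nat where n: "x <\<^sub>P f [^] n"
    using bound x by blast
  obtain m :: nat where m: "inv x <\<^sub>P f [^] m"
    using bound x by blast
  have "x \<otimes> inv x \<otimes> f [^] (- int m) <\<^sub>P x \<otimes> f [^] m \<otimes> f [^] (- int m)"
    using m x by (intro lt_mult_right lt_mult_left) auto
  moreover have "x \<otimes> f [^] m \<otimes> f [^] (- int m) = x"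
    using x by (simp add: m_assoc int_pow_neg int_pow_int)
  ultimately have m': "f [^] (- int m) <\<^sub>P x"
    using x by simp
  \<comment> \<open>the least \<open>j\<close> with \<open>x < f [^] (j - m)\<close> is positive, and its predecessor gives the integer part\<close>
  define above where "above j \<longleftrightarrow> x <\<^sub>P f [^] (int j - int m)" for j
  have "above (n + m)"
    using n by (simp add: above_def int_pow_int)
  moreover have "\<not> above 0"
    using lt_trans[OF m', of "f [^] (- int m)"] by (auto simp: above_def)
  ultimately obtain j where "above (Suc j)" "\<not> above j"
    using ex_least_nat_less[of above "n + m"] by blast
  then have "f [^] (int j - int m) \<le>\<^sub>P x \<and> x <\<^sub>P f [^] ((int j - int m) + 1)"
    using not_le_iff[of "f [^] (int j - int m)" x] x by (simp add: above_def algebra_simps)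
  then show ?thesis ..
qed

text \<open>The integer part of the logarithm of \<open>x\<close> to the base \<open>f\<close>. It is additive up to an error of
\<open>1\<close>, and the embedding into the real numbers is obtained by averaging it over the powers
of \<open>x\<close>.\<close>

definition log_floor :: "'a \<Rightarrow> int" where
  "log_floor x = (SOME k. f [^] k \<le>\<^sub>P x \<and> x <\<^sub>P f [^] (k + 1))"

lemma log_floor:
  assumes "x \<in> carrier G"
  shows "f [^] log_floor x \<le>\<^sub>P x" "x <\<^sub>P f [^] (log_floor x + 1)"
  using someI_ex[OF int_pow_bracket[OF assms]] by (auto simp: log_floor_def)

lemma le_log_floor_iff:
  assumes "x \<in> carrier G"
  shows "k \<le> log_floor x \<longleftrightarrow> f [^] k \<le>\<^sub>P x"
proof
  assume "k \<le> log_floor x"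
  then have "f [^] k \<le>\<^sub>P f [^] log_floor x"
    by (simp only: int_pow_le_iff)
  then show "f [^] k \<le>\<^sub>P x"
    using log_floor(1)[OF assms] by (rule le_trans)
next
  assume "f [^] k \<le>\<^sub>P x"
  then have "f [^] k <\<^sub>P f [^] (log_floor x + 1)"
    using log_floor(2)[OF assms] by (rule le_trans)
  then have "\<not> f [^] (log_floor x + 1) \<le>\<^sub>P f [^] k"
    using not_le_iff by simp
  then show "k \<le> log_floor x"
    unfolding int_pow_le_iff by simp
qed

lemma log_floor_mono:
  assumes "x \<le>\<^sub>P y"
  shows "log_floor x \<le> log_floor y"
proof -
  have c: "x \<in> carrier G" "y \<in> carrier G"
    using assms lt_carrier by blast+
  show ?thesis
    unfolding le_log_floor_iff[OF c(2)] using log_floor(1)[OF c(1)] assms by (rule le_trans)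
qed

lemma log_floor_mult:
  assumes c: "x \<in> carrier G" "y \<in> carrier G"
  shows "log_floor x + log_floor y \<le> log_floor (x \<otimes> y)"
    and "log_floor (x \<otimes> y) \<le> log_floor x + log_floor y + 1"
proof -
  show "log_floor x + log_floor y \<le> log_floor (x \<otimes> y)"
    using c le_mult[OF log_floor(1)[OF c(1)] log_floor(1)[OF c(2)]]
    by (simp add: le_log_floor_iff int_pow_mult)
  have "x \<otimes> y <\<^sub>P f [^] (log_floor x + 1) \<otimes> f [^] (log_floor y + 1)"
    by (rule lt_mult[OF log_floor(2)[OF c(1)] log_floor(2)[OF c(2)]])
  then have "x \<otimes> y <\<^sub>P f [^] (log_floor x + log_floor y + 2)"
    by (simp add: algebra_simps flip: int_pow_mult)
  then have "\<not> f [^] (log_floor x + log_floor y + 2) \<le>\<^sub>P x \<otimes> y"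
    using not_le_iff c by simp
  then have "\<not> log_floor x + log_floor y + 2 \<le> log_floor (x \<otimes> y)"
    using le_log_floor_iff c by simp
  then show "log_floor (x \<otimes> y) \<le> log_floor x + log_floor y + 1"
    by simp
qed

lemma log_floor_one: "log_floor \<one> = 0"
proof -
  have ne: "f \<noteq> \<one>"
    using f one_notin_P by metis
  have "0 \<le> log_floor \<one>"
    by (simp add: le_log_floor_iff)
  moreover have "\<not> 1 \<le> log_floor \<one>"
    using P_not_inv[OF f] ne by (auto simp: le_log_floor_iff)
  ultimately show ?thesis by simp
qed

lemma log_floor_pow:
  assumes x: "x \<in> carrier G"
  shows "int n * log_floor x \<le> log_floor (x [^] n)"
    and "log_floor (x [^] n) \<le> int n * log_floor x + int n"
proof (induction n)
  case (Suc n)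
  {
    case 1
    then show ?case
      using Suc(1) log_floor_mult(1)[of "x [^] n" x] x by (simp add: algebra_simps)
  next
    case 2
    then show ?case
      using Suc(2) log_floor_mult(2)[of "x [^] n" x] x by (simp add: algebra_simps)
  }
qed (simp_all add: log_floor_one)

text \<open>The three elements in \<open>pow_mult_bounds\<close> have nearly the same \<open>log_floor\<close>, because the outer two
are products of the same two factors in different order.\<close>

lemma log_floor_pow_mult:
  assumes c: "x \<in> carrier G" "y \<in> carrier G"
  shows "\<bar>log_floor ((x \<otimes> y) [^] (n::nat)) - log_floor (x [^] n) - log_floor (y [^] n)\<bar> \<le> 1"
proof -
  have xy: "log_floor (x [^] n) + log_floor (y [^] n) \<le> log_floor (x [^] n \<otimes> y [^] n)"
    "log_floor (x [^] n \<otimes> y [^] n) \<le> log_floor (x [^] n) + log_floor (y [^] n) + 1"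
    "log_floor (x [^] n) + log_floor (y [^] n) \<le> log_floor (y [^] n \<otimes> x [^] n)"
    "log_floor (y [^] n \<otimes> x [^] n) \<le> log_floor (x [^] n) + log_floor (y [^] n) + 1"
    using log_floor_mult[of "x [^] n" "y [^] n"] log_floor_mult[of "y [^] n" "x [^] n"] c by auto
  consider "x \<otimes> y \<le>\<^sub>P y \<otimes> x" | "y \<otimes> x \<le>\<^sub>P x \<otimes> y"
    using lt_total[of "x \<otimes> y" "y \<otimes> x"] c by auto
  then show ?thesis
  proof cases
    case 1
    note b = pow_mult_bounds[OF c 1, of n]
    have "log_floor (x [^] n \<otimes> y [^] n) \<le> log_floor ((x \<otimes> y) [^] n)"
      by (rule log_floor_mono[OF b(1)])
    moreover have "log_floor ((x \<otimes> y) [^] n) \<le> log_floor (y [^] n \<otimes> x [^] n)"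
      by (rule log_floor_mono[OF le_trans(1)[OF b(2) b(3)]])
    ultimately show ?thesis
      using xy by linarith
  next
    case 2
    note b = pow_mult_bounds[OF c(2,1) 2, of n]
    have "log_floor (y [^] n \<otimes> x [^] n) \<le> log_floor ((x \<otimes> y) [^] n)"
      by (rule log_floor_mono[OF le_trans(1)[OF b(1) b(2)]])
    moreover have "log_floor ((x \<otimes> y) [^] n) \<le> log_floor (x [^] n \<otimes> y [^] n)"
      by (rule log_floor_mono[OF b(3)])
    ultimately show ?thesis
      using xy by linarith
  qed
qed

text \<open>Let \<open>\<phi> x\<close> be the slope of \<open>n \<mapsto> log_floor (x [^] n)\<close>. By \<open>log_floor_pow_mult\<close> the numbers
\<open>q * \<phi> (x \<otimes> y)\<close> and \<open>q * (\<phi> x + \<phi> y)\<close> differ by at most \<open>3\<close> for all \<open>q > 0\<close>, so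
\<open>\<phi>\<close> is additive. It is positive at \<open>x > \<one>\<close> because some power of \<open>x\<close> exceeds \<open>f\<close>.\<close>

lemma holder_embedding_unit:
  assumes arch: "\<And>x. x \<in> P \<Longrightarrow> \<exists>n::nat. f <\<^sub>P x [^] n"
  obtains \<phi> :: "'a \<Rightarrow> real" where
    "\<And>x y. x \<in> carrier G \<Longrightarrow> y \<in> carrier G \<Longrightarrow> \<phi> (x \<otimes> y) = \<phi> x + \<phi> y"
    "\<And>x. x \<in> P \<Longrightarrow> 0 < \<phi> x"
proof -
  have "\<exists>r::real. \<forall>q>0. log_floor (x [^] (q::nat)) \<le> real q * r \<and> real q * r \<le> log_floor (x [^] q) + 1"
    if x: "x \<in> carrier G" for x
    using log_floor_pow x by (intro almost_homogeneous_slope) (auto simp flip: nat_pow_pow)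
  then obtain \<phi> where
    \<phi>: "\<And>x q. x \<in> carrier G \<Longrightarrow> 0 < q \<Longrightarrow> log_floor (x [^] q) \<le> real q * \<phi> x"
      "\<And>x q. x \<in> carrier G \<Longrightarrow> 0 < q \<Longrightarrow> real q * \<phi> x \<le> log_floor (x [^] q) + 1"
    by metis
  show ?thesis
  proof
    fix x y assume c: "x \<in> carrier G" "y \<in> carrier G"
    define d where "d = \<phi> (x \<otimes> y) - \<phi> x - \<phi> y"
    have bound: "real q * \<bar>d\<bar> \<le> 3" if q: "0 < q" for q :: nat
    proof -
      have "\<bar>real_of_int (log_floor ((x \<otimes> y) [^] q)) - log_floor (x [^] q) - log_floor (y [^] q)\<bar> \<le> 1"
        using log_floor_pow_mult[OF c, of q] by linarith
      then have "\<bar>real q * \<phi> (x \<otimes> y) - real q * \<phi> x - real q * \<phi> y\<bar> \<le> 3"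
        using \<phi>[OF c(1) q] \<phi>[OF c(2) q] \<phi>[OF m_closed[OF c] q] by linarith
      also have "real q * \<phi> (x \<otimes> y) - real q * \<phi> x - real q * \<phi> y = real q * d"
        by (simp add: d_def algebra_simps)
      finally show ?thesis by (simp add: abs_mult)
    qed
    have "d = 0"
    proof (rule ccontr)
      assume "d \<noteq> 0"
      then obtain q :: nat where q: "3 < real q * \<bar>d\<bar>"
        using reals_Archimedean3[of "\<bar>d\<bar>"] by auto
      then have "0 < q" by (cases q) auto
      with bound[of q] q show False by simp
    qed
    then show "\<phi> (x \<otimes> y) = \<phi> x + \<phi> y"
      by (simp add: d_def)
  next
    fix x assume x: "x \<in> P"
    then obtain n :: nat where n: "f <\<^sub>P x [^] n"
      using arch by blast
    have "n \<noteq> 0"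
      using n P_not_inv[OF f] by (cases "n = 0") auto
    have "f [^] (1::int) \<le>\<^sub>P x [^] n"
      using n by simp
    then have "1 \<le> log_floor (x [^] n)"
      using le_log_floor_iff[of "x [^] n" 1] x by simp
    then have "1 \<le> real n * \<phi> x"
      using \<phi>(1)[of x n] x \<open>n \<noteq> 0\<close> by simp
    then have "0 < real n * \<phi> x"
      by linarith
    then show "0 < \<phi> x"
      by (simp add: zero_less_mult_iff)
  qed
qed

end

end

end

text \<open>Hoelder's theorem: an Archimedean two-sided invariant ordering comes from the real numbers. In
particular the group is abelian, which the rank hypothesis needs.\<close>

lemma (in bi_ordered_group) holder_embedding:
  assumes archimedean: "\<And>x y. x \<in> P \<Longrightarrow> y \<in> P \<Longrightarrow> \<exists>n::nat. x <\<^sub>P y [^] n"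
  obtains \<phi> :: "'a \<Rightarrow> real" where
    "\<And>x y. x \<in> carrier G \<Longrightarrow> y \<in> carrier G \<Longrightarrow> \<phi> (x \<otimes> y) = \<phi> x + \<phi> y"
    "\<And>x. x \<in> P \<Longrightarrow> 0 < \<phi> x"
proof (cases "P = {}")
  case True
  then show ?thesis
    using that[of "\<lambda>_. 0"] by simp
next
  case False
  then obtain f where f: "f \<in> P"
    by blast
  show ?thesis
    by (rule holder_embedding_unit[OF f]) (use archimedean f that in blast)+
qed

section \<open>Orderings induced by embeddings into the real numbers\<close>

locale real_hom = group G for G (structure) +
  fixes \<phi> :: "'a \<Rightarrow> real"
  assumes map_mult: "x \<in> carrier G \<Longrightarrow> y \<in> carrier G \<Longrightarrow> \<phi> (x \<otimes> y) = \<phi> x + \<phi> y"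
begin

lemma map_one [simp]: "\<phi> \<one> = 0"
  using map_mult[of \<one> \<one>] by simp

lemma map_inv [simp]: "x \<in> carrier G \<Longrightarrow> \<phi> (inv x) = - \<phi> x"
  using map_mult[of x "inv x"] by simp

lemma map_pow [simp]: "x \<in> carrier G \<Longrightarrow> \<phi> (x [^] (n::nat)) = n * \<phi> x"
  by (induction n) (simp_all add: map_mult algebra_simps)

lemma map_int_pow [simp]: "x \<in> carrier G \<Longrightarrow> \<phi> (x [^] (k::int)) = k * \<phi> x"
  by (cases k rule: int_cases2) (simp_all add: int_pow_int int_pow_neg)

end

locale real_embedding = real_hom +
  assumes map_eq_0: "x \<in> carrier G \<Longrightarrow> \<phi> x = 0 \<Longrightarrow> x = \<one>"
begin

lemma map_inject:
  assumes "x \<in> carrier G" "y \<in> carrier G" "\<phi> x = \<phi> y"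
  shows "x = y"
proof -
  have "x \<otimes> inv y = \<one>"
    using assms by (intro map_eq_0) (simp_all add: map_mult)
  then show ?thesis
    using assms by (metis inv_equality inv_inv inv_closed)
qed

lemma commutative: "comm_group G"
  by (intro group_comm_groupI map_inject) (simp_all add: map_mult)

definition pullback_cone :: "'a set" where
  "pullback_cone = {x \<in> carrier G. 0 < \<phi> x}"

lemma pullback_cone: "pullback_cone \<in> LO G"
proof -
  have "(g \<in> pullback_cone) \<noteq> (inv g \<in> pullback_cone)" if "g \<in> carrier G" "g \<noteq> \<one>" for g
    using that map_eq_0[of g] by (cases "\<phi> g" "0 :: real" rule: linorder_cases) (auto simp: pullback_cone_def)
  moreover have "g \<otimes> h \<in> pullback_cone" if "g \<in> pullback_cone" "h \<in> pullback_cone" for g h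
    using that by (auto simp: pullback_cone_def map_mult)
  ultimately show ?thesis
    unfolding LO_iff by (auto simp: pullback_cone_def)
qed

lemma dense_pullback_cone_iff:
  "dense_ordering (cone_ordering G pullback_cone) \<longleftrightarrow>
     (\<forall>x\<in>carrier G. 0 < \<phi> x \<longrightarrow> (\<exists>y\<in>carrier G. 0 < \<phi> y \<and> \<phi> y < \<phi> x))"
  unfolding dense_cone_iff[OF pullback_cone]
  by (fastforce simp: pullback_cone_def map_mult)

text \<open>If \<open>\<phi> x\<close> were the least positive value, division with remainder would make every value an
integer multiple of \<open>\<phi> x\<close>, and all quotients of values would be rational.\<close>

lemma dense_pullback_cone:
  assumes a: "a \<in> carrier G" and b: "b \<in> carrier G" and irrational: "\<phi> a / \<phi> b \<notin> \<rat>"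
  shows "dense_ordering (cone_ordering G pullback_cone)"
  unfolding dense_pullback_cone_iff
proof (intro ballI impI, rule ccontr)
  fix x assume x: "x \<in> carrier G" "0 < \<phi> x" and "\<not> (\<exists>y\<in>carrier G. 0 < \<phi> y \<and> \<phi> y < \<phi> x)"
  then have least: "\<not> (0 < \<phi> y \<and> \<phi> y < \<phi> x)" if "y \<in> carrier G" for y
    using that by blast
  have "\<exists>k::int. \<phi> z = k * \<phi> x" if z: "z \<in> carrier G" for z
  proof
    \<comment> \<open>\<open>z \<otimes> x [^] (- k)\<close> has value in the interval from \<open>0\<close> to \<open>\<phi> x\<close>, the right end excluded\<close>
    define k where "k = \<lfloor>\<phi> z / \<phi> x\<rfloor>"
    have "of_int k \<le> \<phi> z / \<phi> x" "\<phi> z / \<phi> x < of_int k + 1"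
      by (simp_all add: k_def)
    then have "k * \<phi> x \<le> \<phi> z" "\<phi> z < k * \<phi> x + \<phi> x"
      using x(2) by (simp_all add: field_simps)
    moreover have "\<phi> (z \<otimes> x [^] (- k)) = \<phi> z - k * \<phi> x"
      using z x by (simp add: map_mult)
    ultimately show "\<phi> z = k * \<phi> x"
      using least[of "z \<otimes> x [^] (- k)"] z x by auto
  qed
  then obtain k l :: int where "\<phi> a = k * \<phi> x" "\<phi> b = l * \<phi> x"
    using a b by blast
  then have "\<phi> a / \<phi> b = of_int k / of_int l"
    using x(2) by simp
  with irrational show False by simp
qed

lemma not_dense_if_cyclic:
  assumes iso: "G \<cong> integer_group" and nontrivial: "carrier G \<noteq> {\<one>}"
  shows "\<not> dense_ordering (cone_ordering G pullback_cone)"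
proof
  assume dense: "dense_ordering (cone_ordering G pullback_cone)"
  obtain h where h: "h \<in> iso G integer_group"
    using iso unfolding is_iso_def by blast
  then have hom: "h \<in> hom G integer_group" and bij: "bij_betw h (carrier G) UNIV"
    by (auto simp: iso_def)
  obtain c where c: "c \<in> carrier G" "h c = 1"
    using bij by (metis UNIV_I bij_betw_imp_surj_on imageE)
  interpret h: group_hom G integer_group h
    using hom by (simp add: group_hom_def group_hom_axioms_def group_axioms)
  have "h (c [^] k) = k" for k :: int
    using h.hom_int_pow[OF c(1), of k] c(2) by simp
  then have "x = c [^] h x" if "x \<in> carrier G" for x
    using bij that c(1) by (metis bij_betw_imp_inj_on inj_onD int_pow_closed)
  then have mult: "\<phi> x = h x * \<phi> c" if "x \<in> carrier G" for x
    using that map_int_pow[OF c(1)] by metis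
  have "\<phi> c \<noteq> 0"
  proof
    assume "\<phi> c = 0"
    then have "x = \<one>" if "x \<in> carrier G" for x
      using mult[OF that] that map_eq_0 by simp
    with nontrivial show False
      using one_closed by blast
  qed
  define p where "p = (if 0 < \<phi> c then c else inv c)"
  have p: "p \<in> carrier G" "\<phi> p = \<bar>\<phi> c\<bar>" "0 < \<phi> p"
    using c(1) \<open>\<phi> c \<noteq> 0\<close> by (auto simp: p_def)
  then obtain y where y: "y \<in> carrier G" "0 < \<phi> y" "\<phi> y < \<bar>\<phi> c\<bar>"
    using dense p(1,3) unfolding dense_pullback_cone_iff p(2)[symmetric] by blast
  then have "\<bar>real_of_int (h y)\<bar> * \<bar>\<phi> c\<bar> < 1 * \<bar>\<phi> c\<bar>"
    using mult[OF y(1)] by (simp flip: abs_mult)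
  then have "h y = 0"
    unfolding mult_less_cancel_right by auto
  with mult[OF y(1)] y(2) show False by simp
qed

end

text \<open>Two real numbers with irrational quotient are linearly independent over the rational numbers, and
every function on an independent set extends to a linear map.\<close>

lemma rat_linear_functional:
  fixes s t :: real
  assumes "t \<noteq> 0" "s / t \<notin> \<rat>"
  obtains L :: "real \<Rightarrow> rat" where
    "\<And>x y. L (x + y) = L x + L y" "\<And>q x. L (of_rat q * x) = q * L x" "L s = 1" "L t = 0"
proof -
  interpret R: vector_space "\<lambda>(q::rat) (x::real). of_rat q * x"
    by unfold_locales (simp_all add: algebra_simps of_rat_add of_rat_mult)
  interpret Q: vector_space "(*) :: rat \<Rightarrow> rat \<Rightarrow> rat"
    by unfold_locales (simp_all add: algebra_simps)
  interpret RQ: vector_space_pair "\<lambda>(q::rat) (x::real). of_rat q * x" "(*) :: rat \<Rightarrow> rat \<Rightarrow> rat" ..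
  have "s \<notin> R.span {t}"
  proof
    assume "s \<in> R.span {t}"
    then obtain q where "s = of_rat q * t"
      by (auto simp: R.span_singleton)
    with assms show False by simp
  qed
  moreover have "s \<noteq> t"
    using assms by auto
  ultimately have "R.independent {s, t}"
    using assms(1) by (simp add: R.independent_insert)
  then obtain L where L: "Vector_Spaces.linear (\<lambda>(q::rat) (x::real). of_rat q * x) ((*) :: rat \<Rightarrow> rat \<Rightarrow> rat) L"
    "\<forall>x\<in>{s, t}. L x = (if x = s then 1 else 0)"
    using RQ.linear_independent_extend[of "{s, t}" "\<lambda>x. if x = s then 1 else 0"] by blast
  interpret L: Vector_Spaces.linear "\<lambda>(q::rat) (x::real). of_rat q * x" "(*) :: rat \<Rightarrow> rat \<Rightarrow> rat" L
    by (fact L(1))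
  show ?thesis
    using that[of L] L.add L.scale L(2) \<open>s \<noteq> t\<close> by simp
qed

text \<open>With \<open>L\<close> rational linear, \<open>L (\<phi> a) = 1\<close> and \<open>L (\<phi> b) = 0\<close>, the map \<open>\<psi>\<close> with
\<open>\<psi> x = \<phi> x + \<delta> * L (\<phi> x) * \<phi> b\<close> is again an embedding for every rational \<open>\<delta>\<close>. It
moves \<open>\<phi> a / \<phi> b\<close> to the irrational number \<open>\<phi> a / \<phi> b + \<delta>\<close>, so its ordering is dense and
different from the old one, while a small \<open>\<delta>\<close> keeps the finite set \<open>F\<close> positive.\<close>

lemma (in real_embedding) dense_cone_near_pullback_cone:
  assumes a: "a \<in> carrier G" and b: "b \<in> carrier G" and irrational: "\<phi> a / \<phi> b \<notin> \<rat>"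
    and F: "finite F" "F \<subseteq> pullback_cone"
  obtains Q where "Q \<in> LO G" "dense_ordering (cone_ordering G Q)" "F \<subseteq> Q" "Q \<noteq> pullback_cone"
proof -
  have b0: "\<phi> b \<noteq> 0"
    using irrational by auto
  obtain L where L: "\<And>x y. L (x + y) = L x + L y" "\<And>q x. L (of_rat q * x) = q * L x"
      "L (\<phi> a) = 1" "L (\<phi> b) = 0"
    using rat_linear_functional[OF b0 irrational] by blast
  \<comment> \<open>adding \<open>1\<close> to the denominators avoids division by zero, and the entry \<open>1\<close> covers an empty \<open>F\<close>\<close>
  define \<epsilon> where "\<epsilon> = Min (insert 1 ((\<lambda>x. \<phi> x / (\<bar>of_rat (L (\<phi> x)) * \<phi> b\<bar> + 1)) ` F))"
  have "0 < \<epsilon>"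
    using F by (auto simp: \<epsilon>_def pullback_cone_def intro!: divide_pos_pos)
  then obtain \<delta> where \<delta>: "0 < real_of_rat \<delta>" "real_of_rat \<delta> < \<epsilon>"
    using of_rat_dense[OF \<open>0 < \<epsilon>\<close>] by auto
  define \<psi> where "\<psi> x = \<phi> x + of_rat (\<delta> * L (\<phi> x)) * \<phi> b" for x
  interpret \<psi>: real_embedding G \<psi>
  proof
    show "\<psi> (x \<otimes> y) = \<psi> x + \<psi> y" if "x \<in> carrier G" "y \<in> carrier G" for x y
      using that by (simp add: \<psi>_def map_mult L of_rat_add of_rat_mult algebra_simps)
    fix x assume x: "x \<in> carrier G" "\<psi> x = 0"
    then have eq: "\<phi> x = of_rat (- \<delta> * L (\<phi> x)) * \<phi> b"
      by (simp add: \<psi>_def of_rat_minus)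
    \<comment> \<open>\<open>\<phi> x\<close> is a rational multiple of \<open>\<phi> b\<close>, and \<open>L\<close> vanishes there\<close>
    have "L (\<phi> x) = - \<delta> * L (\<phi> x) * L (\<phi> b)"
      by (subst eq) (rule L(2))
    with eq have "\<phi> x = 0"
      by (simp add: L)
    with x show "x = \<one>"
      by (intro map_eq_0)
  qed
  have \<psi>b: "\<psi> b = \<phi> b" and \<psi>a: "\<psi> a = \<phi> a + of_rat \<delta> * \<phi> b"
    by (simp_all add: \<psi>_def L)
  have "\<psi> a / \<psi> b = \<phi> a / \<phi> b + of_rat \<delta>"
    using b0 by (simp add: \<psi>a \<psi>b field_simps)
  then have "\<psi> a / \<psi> b \<notin> \<rat>"
    using irrational Rats_diff[of "\<phi> a / \<phi> b + of_rat \<delta>" "of_rat \<delta>"] by auto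
  then have "dense_ordering (cone_ordering G \<psi>.pullback_cone)"
    using a b by (intro \<psi>.dense_pullback_cone)
  moreover have "F \<subseteq> \<psi>.pullback_cone"
  proof
    fix x assume x: "x \<in> F"
    let ?M = "\<bar>of_rat (L (\<phi> x)) * \<phi> b\<bar>"
    have "of_rat \<delta> < \<phi> x / (?M + 1)"
      using \<delta>(2) F(1) x by (simp add: \<epsilon>_def)
    then have "of_rat \<delta> * (?M + 1) < \<phi> x"
      by (simp add: pos_less_divide_eq add_nonneg_pos)
    moreover have "\<bar>of_rat (\<delta> * L (\<phi> x)) * \<phi> b\<bar> = of_rat \<delta> * ?M"
      using \<delta>(1) by (simp add: of_rat_mult abs_mult)
    moreover have "of_rat \<delta> * ?M \<le> of_rat \<delta> * (?M + 1)"
      using \<delta>(1) by (simp add: mult_left_mono)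
    ultimately have "0 < \<psi> x"
      unfolding \<psi>_def by linarith
    then show "x \<in> \<psi>.pullback_cone"
      using x F(2) by (auto simp: \<psi>.pullback_cone_def pullback_cone_def)
  qed
  moreover have "\<psi>.pullback_cone \<noteq> pullback_cone"
  proof
    assume same: "\<psi>.pullback_cone = pullback_cone"
    \<comment> \<open>an element whose value \<open>u * \<phi> b\<close> changes its sign, as \<open>- 1 < u < 0 < u + k * \<delta>\<close>\<close>
    obtain k :: nat where k: "1 < real k * of_rat \<delta>"
      using reals_Archimedean3[OF \<delta>(1)] by blast
    define l where "l = \<lceil>real k * (\<phi> a / \<phi> b)\<rceil>"
    define x where "x = a [^] k \<otimes> b [^] (- l)"
    define u where "u = real k * (\<phi> a / \<phi> b) - l"
    have x: "x \<in> carrier G"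
      using a b by (simp add: x_def)
    have \<phi>x: "\<phi> x = u * \<phi> b"
      using a b b0 by (simp add: x_def u_def map_mult field_simps)
    have \<psi>x: "\<psi> x = (u + real k * of_rat \<delta>) * \<phi> b"
      using a b b0 by (simp add: x_def u_def \<psi>.map_mult \<psi>a \<psi>b field_simps)
    have "k \<noteq> 0"
      using k by (cases "k = 0") auto
    have "u \<noteq> 0"
    proof
      assume "u = 0"
      then have "\<phi> a / \<phi> b = of_int l / of_nat k"
        using \<open>k \<noteq> 0\<close> by (simp add: u_def field_simps)
      with irrational show False by simp
    qed
    moreover have "- 1 < u" "u \<le> 0"
      unfolding u_def l_def by linarith+
    ultimately have "u < 0" "0 < u + real k * of_rat \<delta>"
      using k by simp_all
    then have "(0 < \<phi> x) \<noteq> (0 < \<psi> x)"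
      unfolding \<phi>x \<psi>x using b0 by (auto simp: zero_less_mult_iff)
    then show False
      using same x by (auto simp: \<psi>.pullback_cone_def pullback_cone_def)
  qed
  ultimately show thesis
    using that \<psi>.pullback_cone by blast
qed

section \<open>Commensurable values force rank one\<close>

text \<open>The vector \<open>f \<otimes> 1\<close> is a basis of the tensor product with the rational numbers. It spans: if
\<open>\<phi> a / \<phi> f = m / n\<close> then \<open>a [^] n = f [^] m\<close>, hence
\<open>a \<otimes> q = a [^] n \<otimes> (q / n) = f [^] m \<otimes> (q / n) = f \<otimes> (m * q / n)\<close>. It is nonzero, because
\<open>a \<otimes> q \<mapsto> \<phi> a * q\<close> is a homomorphism to the real numbers that does not vanish on it.

In the proof, \<open>N\<close> is the subgroup generated by the bilinearity relators, and \<open>cs x\<close> is the coset of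
\<open>x\<close>. Equality of tensors becomes membership of a difference in \<open>N\<close>.\<close>

lemma (in real_embedding) rank_one_if_commensurable:
  assumes f: "f \<in> carrier G" and f0: "\<phi> f \<noteq> 0"
    and rational: "\<And>x. x \<in> carrier G \<Longrightarrow> \<phi> x / \<phi> f \<in> \<rat>"
  shows "rank_one G"
proof -
  interpret V: vectorspace class_ring "tensor_rat G"
    by (rule vectorspace_tensor_rat[OF commutative])
  define T where "T = tensor_rat_free G"
  define N where "N = tensor_rat_kernel G"
  define cs where "cs x = N #>\<^bsub>T\<^esub> x" for x
  interpret T: comm_group T
    unfolding T_def by (rule abelian_free_Abelian_group)
  have T_carrier: "x \<in> carrier T \<longleftrightarrow> Poly_Mapping.keys x \<subseteq> carrier G \<times> UNIV" for x
    by (auto simp: T_def)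
  have T_mult: "x \<otimes>\<^bsub>T\<^esub> y = x + y" and T_one: "\<one>\<^bsub>T\<^esub> = 0" for x y
    by (simp_all add: T_def)
  have frag_T: "frag_of (a, q) \<in> carrier T" if "a \<in> carrier G" for a q
    using that by (simp add: T_carrier)
  have diff_T: "x - y \<in> carrier T" if "x \<in> carrier T" "y \<in> carrier T" for x y
    using that keys_diff[of x y] unfolding T_carrier by blast
  have rel: "tensor_rat_relators G \<subseteq> carrier T"
    unfolding tensor_rat_relators_def by (auto intro!: diff_T frag_T)
  have N_eq: "N = generate T (tensor_rat_relators G)"
    by (simp add: N_def T_def)
  have subN: "subgroup N T"
    unfolding N_eq using rel by (rule T.generate_is_subgroup)
  have N_T: "N \<subseteq> carrier T"
    using subN by (rule subgroup.subset)
  have N0: "0 \<in> N" and N_add: "\<And>x y. x \<in> N \<Longrightarrow> y \<in> N \<Longrightarrow> x + y \<in> N"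
    using subgroup.one_closed[OF subN] subgroup.m_closed[OF subN] by (simp_all add: T_mult T_one)
  have N_minus: "- x \<in> N" if "x \<in> N" for x
  proof -
    have "x \<in> carrier T" using N_T that by blast
    then have "inv\<^bsub>T\<^esub> x = - x"
      unfolding T_carrier by (simp add: T_def)
    then show ?thesis
      using subgroup.m_inv_closed[OF subN that] by simp
  qed
  have N_diff: "x - y \<in> N" if "x \<in> N" "y \<in> N" for x y
    using N_add[OF that(1) N_minus[OF that(2)]] by simp
  have rel_mult: "frag_of (a \<otimes> b, q) - frag_of (a, q) - frag_of (b, q) \<in> N"
    if "a \<in> carrier G" "b \<in> carrier G" for a b q
    unfolding N_eq tensor_rat_relators_def using that by (intro generate.incl) blast
  have rel_add: "frag_of (a, p + q) - frag_of (a, p) - frag_of (a, q) \<in> N"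
    if "a \<in> carrier G" for a p q
    unfolding N_eq tensor_rat_relators_def using that by (intro generate.incl) blast
  have cs_eq: "cs x = cs y" if "x - y \<in> N" for x y
  proof -
    have cs: "cs z = (\<lambda>n. n + z) ` N" for z
      by (auto simp: cs_def r_coset_def T_mult)
    have "n + x = (n + (x - y)) + y" "n + y = (n - (x - y)) + x" for n
      by simp_all
    then show ?thesis
      unfolding cs using N_add N_diff that
      by (metis (no_types, lifting) image_subset_iff image_eqI subset_antisym)
  qed
  have carr: "carrier (tensor_rat G) = cs ` carrier T"
    by (simp add: tensor_rat_def carrier_FactGroup cs_def flip: T_def N_eq)
  \<comment> \<open>\<open>a [^] k \<otimes> q = a \<otimes> (k * q)\<close>\<close>
  have pow: "frag_of (a [^] k, q) - frag_of (a, of_int k * q) \<in> N"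
    if a: "a \<in> carrier G" for a q and k :: int
  proof (induction k rule: int_induct[of _ 0])
    case base
    have "- (frag_of (\<one> \<otimes> \<one>, q) - frag_of (\<one>, q) - frag_of (\<one>, q)) \<in> N"
      by (intro N_minus rel_mult) simp_all
    moreover have "- (frag_of (a, 0 + 0) - frag_of (a, 0) - frag_of (a, 0)) \<in> N"
      by (intro N_minus rel_add a)
    ultimately have "frag_of (\<one>, q) \<in> N" "frag_of (a, 0) \<in> N"
      by simp_all
    then show ?case
      using N_diff by simp
  next
    case (step1 k)
    have "(frag_of (a [^] k, q) - frag_of (a, of_int k * q)) +
        ((frag_of (a [^] k \<otimes> a, q) - frag_of (a [^] k, q) - frag_of (a, q)) -
         (frag_of (a, of_int k * q + q) - frag_of (a, of_int k * q) - frag_of (a, q))) \<in> N"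
      by (rule N_add[OF step1(2) N_diff[OF rel_mult[OF int_pow_closed[OF a] a] rel_add[OF a]]])
    moreover have "a [^] k \<otimes> a = a [^] (k + 1)"
      using a by (simp add: int_pow_mult)
    ultimately show ?case
      by (simp add: distrib_right)
  next
    case (step2 k)
    have "(frag_of (a [^] k, q) - frag_of (a, of_int k * q)) -
        ((frag_of (a [^] (k - 1) \<otimes> a, q) - frag_of (a [^] (k - 1), q) - frag_of (a, q)) -
         (frag_of (a, of_int (k - 1) * q + q) - frag_of (a, of_int (k - 1) * q) - frag_of (a, q))) \<in> N"
      by (rule N_diff[OF step2(2) N_diff[OF rel_mult[OF int_pow_closed[OF a] a] rel_add[OF a]]])
    moreover have "a [^] (k - 1) \<otimes> a = a [^] k"
      using a int_pow_mult[of a "k - 1" 1] by simp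
    moreover have "of_int (k - 1) * q + q = of_int k * q"
      by (simp add: algebra_simps)
    ultimately show ?case
      by simp
  qed
  have multiple: "\<exists>s. x - frag_of (f, s) \<in> N" if "x \<in> carrier T" for x
    using that unfolding T_carrier
  proof (induction rule: frag_induction)
    case zero
    show ?case
      using rel_add[OF f, of 0 0] by (intro exI[of _ 0]) simp
  next
    case (one y)
    then obtain a q where y: "y = (a, q)" and a: "a \<in> carrier G"
      by auto
    obtain m n :: int where n: "n \<noteq> 0" and mn: "\<phi> a / \<phi> f = of_int m / of_int n"
      using rational[OF a] by (metis Rats_cases' less_irrefl)
    have power_eq: "a [^] n = f [^] m"
      using a f n f0 mn by (intro map_inject) (simp_all add: field_simps)
    have "(frag_of (f [^] m, q / of_int n) - frag_of (f, of_int m * (q / of_int n))) -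
        (frag_of (f [^] m, q / of_int n) - frag_of (a, of_int n * (q / of_int n))) \<in> N"
      by (rule N_diff[OF pow[OF f] pow[OF a, of n, unfolded power_eq]])
    then have "frag_of (a, q) - frag_of (f, of_int m * (q / of_int n)) \<in> N"
      using n by simp
    then show ?case
      unfolding y by blast
  next
    case (diff x y)
    then obtain s t where st: "x - frag_of (f, s) \<in> N" "y - frag_of (f, t) \<in> N"
      by blast
    have "((x - frag_of (f, s)) - (y - frag_of (f, t))) +
        (frag_of (f, (s - t) + t) - frag_of (f, s - t) - frag_of (f, t)) \<in> N"
      by (rule N_add[OF N_diff[OF st] rel_add[OF f]])
    then have "x - y - frag_of (f, s - t) \<in> N"
      by (simp add: algebra_simps)
    then show ?case
      by blast
  qed
  define e where "e = cs (frag_of (f, 1))"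
  have e: "e \<in> carrier (tensor_rat G)"
    unfolding carr e_def using frag_T[OF f] by blast
  have smult_e: "q \<odot>\<^bsub>tensor_rat G\<^esub> e = cs (frag_of (f, q))" for q
  proof -
    \<comment> \<open>the product is some coset, so it is determined by one of its elements\<close>
    have "q \<odot>\<^bsub>tensor_rat G\<^esub> e \<in> carrier (tensor_rat G)"
      using e by (intro V.smult_closed) simp_all
    then obtain x where x: "x \<in> carrier T" "q \<odot>\<^bsub>tensor_rat G\<^esub> e = cs x"
      unfolding carr by blast
    have "frag_of (f, 1) \<in> e"
      unfolding e_def cs_def r_coset_def using N0 by (auto simp: T_mult intro!: bexI[of _ 0])
    then have "0 + tensor_rat_scale q (frag_of (f, 1)) \<in> N <#>\<^bsub>T\<^esub> (tensor_rat_scale q ` e)"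
      unfolding set_mult_def T_mult using N0 by blast
    moreover have "q \<odot>\<^bsub>tensor_rat G\<^esub> e = N <#>\<^bsub>T\<^esub> (tensor_rat_scale q ` e)"
      by (simp add: tensor_rat_def N_def T_def)
    ultimately have "frag_of (f, q) \<in> cs x"
      by (simp add: x(2) tensor_rat_scale_def)
    then show ?thesis
      unfolding x(2) cs_def
      using T.repr_independence[OF _ x(1) subN] by simp
  qed
  have gen: "V.span {e} = carrier (tensor_rat G)"
  proof
    show "V.span {e} \<subseteq> carrier (tensor_rat G)"
      using V.span_is_subset2[of "{e}"] e by simp
    show "carrier (tensor_rat G) \<subseteq> V.span {e}"
    proof
      fix C assume "C \<in> carrier (tensor_rat G)"
      then obtain x where x: "x \<in> carrier T" "C = cs x"
        unfolding carr by blast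
      then obtain s where "C = s \<odot>\<^bsub>tensor_rat G\<^esub> e"
        using multiple cs_eq unfolding smult_e by metis
      also have "\<dots> = V.lincomb (\<lambda>_. s) {e}"
        using e by (simp add: V.lincomb_def)
      finally show "C \<in> V.span {e}"
        unfolding V.span_def by auto
    qed
  qed
  have "e \<noteq> \<zero>\<^bsub>tensor_rat G\<^esub>"
  proof
    assume "e = \<zero>\<^bsub>tensor_rat G\<^esub>"
    then have "cs (frag_of (f, 1)) = N"
      by (simp add: e_def tensor_rat_def N_def)
    then have inN: "frag_of (f, 1) \<in> N"
      unfolding cs_def using T.rcos_self[OF frag_T[OF f, of 1] subN] by simp
    \<comment> \<open>the additive group of the real numbers as a target of \<open>a \<otimes> q \<mapsto> \<phi> a * q\<close>\<close>
    define Reals :: "real monoid" where "Reals = \<lparr>carrier = UNIV, monoid.mult = (+), one = 0\<rparr>"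
    interpret Reals: comm_group Reals
      by (rule comm_groupI) (auto simp: Reals_def intro: exI[of _ "- x" for x])
    obtain h where h: "h \<in> hom T Reals"
      "\<And>z. z \<in> carrier G \<times> UNIV \<Longrightarrow> h (frag_of z) = (case z of (a, q) \<Rightarrow> \<phi> a * of_rat q)"
      unfolding T_def
      by (rule Reals.free_Abelian_group_universal[where f = "\<lambda>(a, q). \<phi> a * of_rat q" and S = "carrier G \<times> UNIV"])
        (auto simp: Reals_def)
    have h_add: "h (x + y) = h x + h y" if "x \<in> carrier T" "y \<in> carrier T" for x y
      using hom_mult[OF h(1) that] by (simp add: T_mult Reals_def)
    have h_diff: "h (x - y) = h x - h y" if "x \<in> carrier T" "y \<in> carrier T" for x y
      using h_add[OF diff_T[OF that] that(2)] by simp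
    have h0: "h x = 0" if "x \<in> tensor_rat_relators G" for x
      using that unfolding tensor_rat_relators_def
      by (elim UnE CollectE exE conjE)
        (simp_all add: h_diff diff_T frag_T h(2) map_mult of_rat_add distrib_left distrib_right)
    interpret h: group_hom T Reals h
      using h(1) by (simp add: group_hom_def group_hom_axioms_def T.group_axioms Reals.group_axioms)
    have "N \<subseteq> kernel T Reals h"
      unfolding N_eq using h0 rel
      by (intro T.generate_subgroup_incl h.subgroup_kernel) (auto simp: kernel_def Reals_def)
    with inN have "h (frag_of (f, 1)) = 0"
      by (auto simp: kernel_def Reals_def)
    with h(2)[of "(f, 1)"] f f0 show False
      by simp
  qed
  then have "V.dim = 1"
    using gen e by (intro V.dim1I)
  moreover have "V.fin_dim"
    unfolding V.fin_dim_def using gen e by (intro exI[of _ "{e}"]) simp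
  ultimately show ?thesis
    by (simp add: rank_one_def)
qed

section \<open>Nearby dense orderings\<close>

context left_ordered_group
begin

lemma finite_lower_bound:
  assumes "finite F" "F \<subseteq> P" "P \<noteq> {}"
  shows "\<exists>f\<in>P. \<forall>x\<in>F. f \<le>\<^sub>P x"
  using assms
proof (induction F rule: finite_induct)
  case (insert y F)
  then obtain f where f: "f \<in> P" "\<forall>x\<in>F. f \<le>\<^sub>P x" and y: "y \<in> P"
    by auto
  show ?case
  proof (cases "f \<le>\<^sub>P y")
    case True
    with f show ?thesis by auto
  next
    case False
    then have yf: "y \<le>\<^sub>P f"
      using not_le_iff[of f y] f y by simp
    have "y \<le>\<^sub>P x" if "x \<in> F" for x
      using le_trans(1)[OF yf] f(2) that by blast
    with y show ?thesis by auto
  qed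
qed auto

text \<open>The first way of changing \<open>P\<close>: conjugation by a small element outside the normalizer.\<close>

lemma dense_cone_nearby_conj:
  assumes dense: "dense_ordering (cone_ordering G P)"
    and g: "g \<in> P" "g \<notin> normalizer" and F: "\<And>x. x \<in> F \<Longrightarrow> g \<le>\<^sub>P x"
  shows "\<exists>Q\<in>LO G. dense_ordering (cone_ordering G Q) \<and> F \<subseteq> Q \<and> Q \<noteq> P"
proof (intro bexI conjI)
  let ?Q = "{x \<in> carrier G. inv g \<otimes> x \<otimes> g \<in> P}"
  show "?Q \<in> LO G" "dense_ordering (cone_ordering G ?Q)"
    using g(1) dense by (auto intro: cone_conj dense_cone_conj)
  show "F \<subseteq> ?Q"
    using conj_small_positive[OF g(1) F] F lt_carrier by blast
  show "?Q \<noteq> P"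
    using g unfolding normalizer_def by auto
qed

text \<open>The second way: reversal of the ordering on a convex subgroup that misses \<open>F\<close>.\<close>

lemma dense_cone_nearby_reverse:
  assumes dense: "dense_ordering (cone_ordering G P)"
    and g: "g \<in> P" and small: "\<And>h. h \<in> P \<Longrightarrow> h \<le>\<^sub>P g \<Longrightarrow> h \<in> normalizer"
    and F: "F \<subseteq> P" "F \<inter> cyclic_hull g = {}"
  shows "\<exists>Q\<in>LO G. dense_ordering (cone_ordering G Q) \<and> F \<subseteq> Q \<and> Q \<noteq> P"
proof (intro bexI conjI)
  let ?H = "cyclic_hull g"
  let ?R = "{x \<in> ?H. inv x \<in> P}"
  note H = subgroup_cyclic_hull[OF g small] convex_cyclic_hull[OF g]
  have gH: "g \<in> ?H"
    by (rule self_in_cyclic_hull[OF g])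
  then have "inv g \<in> ?R"
    using g subgroup.m_inv_closed[OF H(1)] by simp
  then show "dense_ordering (cone_ordering G (?R \<union> (P - ?H)))"
    by (intro dense_convex_replace[OF H cone_reverse[OF H]] dense_reverse[OF H] dense_convex_restrict[OF H] dense) auto
  show "?R \<union> (P - ?H) \<in> LO G"
    by (rule cone_convex_replace[OF H cone_reverse[OF H]])
  show "F \<subseteq> ?R \<union> (P - ?H)"
    using F by blast
  show "?R \<union> (P - ?H) \<noteq> P"
    using gH g P_not_inv by blast
qed

text \<open>The third way: perturbation of the real embedding of an Archimedean convex subgroup \<open>H\<close>. Here the
hypothesis on rank one subgroups enters. If all values of the embedding were commensurable, \<open>H\<close>
would have rank one and be infinite cyclic, and the ordering would have a least positive element.\<close>

lemma dense_cone_nearby_archimedean: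
  assumes dense: "dense_ordering (cone_ordering G P)"
    and H: "subgroup H G" "convex H" and f: "f \<in> P \<inter> H"
    and bi: "bi_ordered_group (G\<lparr>carrier := H\<rparr>) (P \<inter> H)"
    and archimedean: "\<And>x y. x \<in> P \<inter> H \<Longrightarrow> y \<in> P \<inter> H \<Longrightarrow> \<exists>n::nat. x \<le>\<^sub>P y [^] n"
    and rank: "comm_group (G\<lparr>carrier := H\<rparr>) \<Longrightarrow> rank_one (G\<lparr>carrier := H\<rparr>) \<Longrightarrow>
      G\<lparr>carrier := H\<rparr> \<cong> integer_group"
    and F: "finite F" "F \<subseteq> P"
  shows "\<exists>Q\<in>LO G. dense_ordering (cone_ordering G Q) \<and> F \<subseteq> Q \<and> Q \<noteq> P"
proof -
  let ?K = "G\<lparr>carrier := H\<rparr>"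
  interpret K: bi_ordered_group ?K "P \<inter> H"
    by (rule bi)
  interpret H: subgroup H G
    by (rule H(1))
  have K_pow: "x [^]\<^bsub>?K\<^esub> n = x [^] n" for x and n :: nat
    by (simp flip: nat_pow_consistent)
  have "\<exists>n::nat. (x, y [^] n) \<in> cone_ordering ?K (P \<inter> H)" if x: "x \<in> P \<inter> H" and y: "y \<in> P \<inter> H" for x y
  proof -
    obtain n :: nat where n: "x \<le>\<^sub>P y [^] n"
      using archimedean[OF x y] by blast
    \<comment> \<open>one more factor turns the weak inequality into a strict one\<close>
    have "y [^] n <\<^sub>P y [^] Suc n"
      using lt_mult_left[of "y [^] n" \<one> y] y by simp
    then have "x <\<^sub>P y [^] Suc n"
      by (rule le_trans(2)[OF n])
    moreover have "y [^] Suc n \<in> H"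
      using K.nat_pow_closed[of y "Suc n"] y unfolding K_pow by simp
    ultimately show ?thesis
      using x unfolding cone_ordering_subgroup[OF H(1)] by blast
  qed
  then obtain \<phi> :: "'a \<Rightarrow> real" where
    hom: "\<And>x y. x \<in> H \<Longrightarrow> y \<in> H \<Longrightarrow> \<phi> (x \<otimes> y) = \<phi> x + \<phi> y" and
    pos: "\<And>x. x \<in> P \<inter> H \<Longrightarrow> 0 < \<phi> x"
    using K.holder_embedding unfolding K_pow by auto
  interpret \<phi>: real_hom ?K \<phi>
    by unfold_locales (simp add: hom)
  have neg: "\<phi> x < 0" if "x \<in> H" "inv x \<in> P" for x
    using pos[of "inv x"] \<phi>.map_inv[of x] that m_inv_consistent[OF H(1), of x] by simp
  interpret \<phi>: real_embedding ?K \<phi>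
  proof
    fix x assume x: "x \<in> carrier ?K" "\<phi> x = 0"
    then show "x = \<one>\<^bsub>?K\<^esub>"
      using P_or_inv[of x] pos[of x] neg[of x] by fastforce
  qed
  have "x \<in> P" if "x \<in> H" "0 < \<phi> x" for x
    using that neg[of x] P_or_inv[of x] \<phi>.map_one by fastforce
  then have cone_eq: "\<phi>.pullback_cone = P \<inter> H"
    using pos unfolding \<phi>.pullback_cone_def by auto
  have denseH: "dense_ordering (cone_ordering ?K (P \<inter> H))"
    by (rule dense_convex_restrict[OF H dense])
  have nontrivial: "carrier ?K \<noteq> {\<one>\<^bsub>?K\<^esub>}"
    using f by auto
  have "\<exists>a\<in>H. \<phi> a / \<phi> f \<notin> \<rat>"
  proof (rule ccontr)
    assume "\<not> (\<exists>a\<in>H. \<phi> a / \<phi> f \<notin> \<rat>)"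
    then have "rank_one ?K"
      using f pos[OF f] by (intro \<phi>.rank_one_if_commensurable[of f]) auto
    then have "?K \<cong> integer_group"
      by (rule rank[OF \<phi>.commutative])
    then show False
      using \<phi>.not_dense_if_cyclic[OF _ nontrivial] denseH unfolding cone_eq by blast
  qed
  then obtain a where a: "a \<in> H" "\<phi> a / \<phi> f \<notin> \<rat>"
    by blast
  obtain R where R: "R \<in> LO ?K" "dense_ordering (cone_ordering ?K R)" "F \<inter> H \<subseteq> R" "R \<noteq> P \<inter> H"
    using \<phi>.dense_cone_near_pullback_cone[of a f "F \<inter> H"] a f F unfolding cone_eq by auto
  have "f \<in> H" "f \<noteq> \<one>"
    using f by auto
  then have "R \<noteq> {}"
    using R(1) unfolding LO_subgroup_iff[OF H(1)] by blast
  show ?thesis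
  proof (intro bexI conjI)
    show "R \<union> (P - H) \<in> LO G"
      by (rule cone_convex_replace[OF H R(1)])
    show "dense_ordering (cone_ordering G (R \<union> (P - H)))"
      by (rule dense_convex_replace[OF H R(1,2) \<open>R \<noteq> {}\<close>])
    show "F \<subseteq> R \<union> (P - H)"
      using R(3) F(2) by blast
    show "R \<union> (P - H) \<noteq> P"
      using R(1,4) unfolding LO_subgroup_iff[OF H(1)] by blast
  qed
qed

text \<open>Let \<open>f\<close> be positive and below all of \<open>F\<close>. Either some positive \<open>g \<le> f\<close> does not normalize the
cone, or some \<open>g \<le> f\<close> generates a convex subgroup without \<open>f\<close>, which then misses \<open>F\<close>, or
\<open>f\<close> is below a power of each positive \<open>g \<le> f\<close>. The last case says that the ordering is
Archimedean on the convex hull of the powers of \<open>f\<close>.\<close>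

lemma dense_cone_nearby:
  assumes dense: "dense_ordering (cone_ordering G P)" and nontrivial: "carrier G \<noteq> {\<one>}"
    and rank: "\<And>A. subgroup A G \<Longrightarrow> comm_group (G\<lparr>carrier := A\<rparr>) \<Longrightarrow> rank_one (G\<lparr>carrier := A\<rparr>)
           \<Longrightarrow> G\<lparr>carrier := A\<rparr> \<cong> integer_group"
    and F: "finite F" "F \<subseteq> P"
  shows "\<exists>Q\<in>LO G. dense_ordering (cone_ordering G Q) \<and> F \<subseteq> Q \<and> Q \<noteq> P"
proof -
  have "P \<noteq> {}"
    using nontrivial P_or_inv one_closed by blast
  then obtain f where f: "f \<in> P" and lower: "\<And>x. x \<in> F \<Longrightarrow> f \<le>\<^sub>P x"
    using finite_lower_bound[OF F] by blast
  consider (conj) g where "g \<in> P" "g \<le>\<^sub>P f" "g \<notin> normalizer"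
    | (reverse) g where "g \<in> P" "g \<le>\<^sub>P f" "\<And>h. h \<in> P \<Longrightarrow> h \<le>\<^sub>P f \<Longrightarrow> h \<in> normalizer" "f \<notin> cyclic_hull g"
    | (archimedean) "\<And>h. h \<in> P \<Longrightarrow> h \<le>\<^sub>P f \<Longrightarrow> h \<in> normalizer" "\<And>g. g \<in> P \<Longrightarrow> g \<le>\<^sub>P f \<Longrightarrow> f \<in> cyclic_hull g"
    by blast
  then show ?thesis
  proof cases
    case conj
    have "g \<le>\<^sub>P x" if "x \<in> F" for x
      using conj(2) lower[OF that] by (rule le_trans)
    then show ?thesis
      by (rule dense_cone_nearby_conj[OF dense conj(1,3)])
  next
    case reverse
    have small: "h \<in> normalizer" if "h \<in> P" "h \<le>\<^sub>P g" for h
      using reverse(3)[OF that(1)] le_trans(1)[OF that(2) reverse(2)] by blast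
    have "x \<notin> cyclic_hull g" if "x \<in> F" for x
      using lower[OF that] convexD[OF convex_cyclic_hull[OF reverse(1)] f] reverse(4) by blast
    then show ?thesis
      using F(2) by (intro dense_cone_nearby_reverse[OF dense reverse(1) small]) auto
  next
    case archimedean
    let ?H = "cyclic_hull f"
    have H: "subgroup ?H G" "convex ?H"
      using subgroup_cyclic_hull[OF f archimedean(1)] convex_cyclic_hull[OF f] by blast+
    have bi: "bi_ordered_group (G\<lparr>carrier := ?H\<rparr>) (P \<inter> ?H)"
      by (rule bi_ordered_cyclic_hull[OF f archimedean(1)])
    interpret K: bi_ordered_group "G\<lparr>carrier := ?H\<rparr>" "P \<inter> ?H"
      by (rule bi)
    have fH: "f \<in> ?H"
      by (rule self_in_cyclic_hull[OF f])
    have K_pow: "x [^]\<^bsub>G\<lparr>carrier := ?H\<rparr>\<^esub> n = x [^] n" for x and n :: nat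
      by (simp flip: nat_pow_consistent)
    have "\<exists>n::nat. x \<le>\<^sub>P y [^] n" if x: "x \<in> P \<inter> ?H" and y: "y \<in> P \<inter> ?H" for x y
    proof -
      obtain m :: nat where m: "x \<le>\<^sub>P f [^] m"
        using x unfolding cyclic_hull_def by blast
      have "\<exists>k::nat. f \<le>\<^sub>P y [^] k"
      proof (cases "y \<le>\<^sub>P f")
        case True
        then show ?thesis
          using archimedean(2)[of y] y unfolding cyclic_hull_def by blast
      next
        case False
        then have "f \<le>\<^sub>P y [^] (1::nat)"
          using not_le_iff[of y f] f y by simp
        then show ?thesis ..
      qed
      then obtain k :: nat where k: "f \<le>\<^sub>P y [^] k" ..
      have "y [^] k \<in> ?H"
        using K.nat_pow_closed[of y k] y by (simp add: K_pow)
      then have "K.le f (y [^] k)"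
        using k fH by (auto simp: cone_ordering_subgroup[OF H(1), of P])
      from K.le_pow[OF this, of m] have "f [^] m \<le>\<^sub>P (y [^] k) [^] m"
        using f y by (auto simp: K_pow cone_ordering_subgroup[OF H(1), of P])
      then show ?thesis
        using le_trans(1)[OF m] y by (auto simp: nat_pow_pow)
    qed
    then show ?thesis
      using f fH F rank H(1) by (intro dense_cone_nearby_archimedean[OF dense H _ bi]) auto
  qed
qed

end

theorem proposition4p7:
  fixes G :: "('a, 'm) monoid_scheme" and P :: "'a set"
  assumes "group G"
    and "carrier G \<noteq> {\<one>\<^bsub>G\<^esub>}"
    and "\<And>A. subgroup A G \<Longrightarrow> comm_group (G\<lparr>carrier := A\<rparr>) \<Longrightarrow> rank_one (G\<lparr>carrier := A\<rparr>)
           \<Longrightarrow> G\<lparr>carrier := A\<rparr> \<cong> integer_group"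
    and "P \<in> LO G"
    and "dense_ordering (cone_ordering G P)"
  shows "P \<in> LO_topology G derived_set_of {Q \<in> LO G. dense_ordering (cone_ordering G Q)}"
proof (rule accumulation_point_LO_I[OF assms(1,4)])
  interpret left_ordered_group G P
    using assms(1,4) by (simp add: left_ordered_group_def left_ordered_group_axioms_def)
  fix F assume F: "finite F" "F \<subseteq> P"
  show "\<exists>Q\<in>{Q \<in> LO G. dense_ordering (cone_ordering G Q)}. Q \<in> LO G \<and> F \<subseteq> Q \<and> Q \<noteq> P"
    using dense_cone_nearby[OF assms(5,2,3) F] by blast
qed

end
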